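(* Let $m \ge 3$ be a fixed integer and let $G \sim \mathcal{PA}(m;n)$. Then, with high probability as $n\to\infty$, $|\mathrm{Aut}(G)| = 1$. More precisely, for each fixed $m\ge 3$ there is some fixed $\delta>0$ such that, for large $n$, $$P(|\mathrm{Aut}(G)| > 1) = O(n^{-\delta}).$$
   Context: Preferential attachment model: for an integer $m\ge 1$, $\mathcal{PA}(m;n)$ is the distribution of the random multigraph $G_n$ on vertex set $[n]=\{1,\dots,n\}$ built recursively as follows. $G_1$ is the single vertex $1$ with $m$ self-loops (these are the only self-loops in the graph, and each is counted once in the degree of vertex $1$). Given $G_n$, add vertex $n+1$ and let it make $m$ random choices $v_1,\dots,v_m\in[n]$ of neighbors with $$P(v_i = w \mid G_n, v_1,\dots,v_{i-1}) = \frac{\deg_n(w)}{\sum_{u\in[n]}\deg_n(u)} = \frac{\deg_n(w)}{2mn-m},\qquad w\in[n],$$ where $\deg_n(w)$ is the degree of $w$ in $G_n$ (multiplicities counted); one edge joins $n+1$ to each $v_i$, so multiple edges may occur. The result is $G_{n+1}\sim\mathcal{PA}(m;n+1)$. An automorphism of a multigraph is a permutation of its vertex set such that for all vertices $x,y$ the number of edges between $x$ and $y$ equals the number of edges between their images; $\mathrm{Aut}(G)$ is the group of automorphisms. "With high probability" means with probability tending to $1$ as $n\to\infty$. *)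

theory Defs
  imports
    "HOL-Probability.Probability"
    "HOL-Library.Uprod"
    "HOL-Library.Landau_Symbols"
    "HOL-Combinatorics.Permutations"
begin

text \<open>
  A multigraph on the vertex set \<open>{1..n}\<close> is given by its multiset of edges, an edge being an
  unordered pair and \<open>Upair x x\<close> being a loop at \<open>x\<close>.  The vertex set is passed separately,
  through \<open>n\<close>.
\<close>

type_synonym multigraph = "nat uprod multiset"

definition num_edges :: "multigraph \<Rightarrow> nat \<Rightarrow> nat \<Rightarrow> nat" where
  "num_edges G x y = count G (Upair x y)"

text \<open>A loop is a single edge incident with its vertex, so it contributes one to the degree.\<close>

definition deg :: "multigraph \<Rightarrow> nat \<Rightarrow> nat" where
  "deg G v = size {#e \<in># G. v \<in> set_uprod e#}"

definition automorphisms :: "nat \<Rightarrow> multigraph \<Rightarrow> (nat \<Rightarrow> nat) set" where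
  "automorphisms n G = {\<pi>. \<pi> permutes {1..n} \<and>
     (\<forall>x\<in>{1..n}. \<forall>y\<in>{1..n}. num_edges G (\<pi> x) (\<pi> y) = num_edges G x y)}"

definition choice_pmf :: "nat \<Rightarrow> multigraph \<Rightarrow> nat pmf" where
  "choice_pmf n G = embed_pmf (\<lambda>w.
     if w \<in> {1..n} then real (deg G w) / real (\<Sum>u\<in>{1..n}. deg G u) else 0)"

text \<open>
  The degrees are not updated between the \<open>m\<close> choices made by a new vertex, so that these
  choices are independent given the current graph.  The case \<open>n = 0\<close> is a dummy.
\<close>

fun PA :: "nat \<Rightarrow> nat \<Rightarrow> multigraph pmf" where
  "PA m 0 = return_pmf {#}"
| "PA m (Suc 0) = return_pmf (replicate_mset m (Upair 1 1))"
| "PA m (Suc (Suc n)) =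
     bind_pmf (PA m (Suc n)) (\<lambda>G.
       map_pmf (\<lambda>vs. G + mset (map (Upair (Suc (Suc n))) vs))
         (replicate_pmf m (choice_pmf (Suc n) G)))"

text \<open>
  The lemmas below confirm that \<^const>\<open>embed_pmf\<close> is applied to a genuine probability mass
  function and that the normalising constant is \<open>2mn - m\<close>.
\<close>

lemma pmf_choice_pmf:
  assumes "(\<Sum>u\<in>{1..n}. deg G u) > 0"
  shows "pmf (choice_pmf n G) w =
    (if w \<in> {1..n} then real (deg G w) / real (\<Sum>u\<in>{1..n}. deg G u) else 0)"
proof -
  define S where "S = (\<Sum>u\<in>{1..n}. deg G u)"
  define f where "f = (\<lambda>w. if w \<in> {1..n} then real (deg G w) / real S else 0)"
  have "(\<integral>\<^sup>+w. ennreal (f w) \<partial>count_space UNIV) = (\<Sum>w\<in>{1..n}. ennreal (f w))"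
    by (subst nn_integral_count_space'[of "{1..n}"]) (auto simp: f_def)
  also have "\<dots> = ennreal (\<Sum>w\<in>{1..n}. f w)"
    by (rule sum_ennreal) (auto simp: f_def)
  also have "(\<Sum>w\<in>{1..n}. f w) = (\<Sum>w\<in>{1..n}. real (deg G w)) / real S"
    by (simp add: f_def sum_divide_distrib)
  also have "\<dots> = 1"
    using assms unfolding S_def of_nat_sum [symmetric]
    by (metis divide_self_if less_irrefl of_nat_eq_0_iff)
  finally have "pmf (embed_pmf f) w = f w"
    by (intro pmf_embed_pmf) (auto simp: f_def)
  then show ?thesis unfolding choice_pmf_def f_def S_def .
qed

lemma deg_add: "deg (G + H) v = deg G v + deg H v"
  by (simp add: deg_def)

lemma sum_deg_star:
  assumes "set vs \<subseteq> {1..n}"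
  shows "(\<Sum>u\<in>{1..Suc n}. deg (mset (map (Upair (Suc n)) vs)) u) = 2 * length vs"
  using assms
proof (induction vs)
  case Nil
  then show ?case by (simp add: deg_def)
next
  case (Cons v vs)
  have "deg (mset (map (Upair (Suc n)) (v # vs))) u =
      (if u = Suc n then 1 else 0) + (if u = v then 1 else 0) +
      deg (mset (map (Upair (Suc n)) vs)) u" for u
    using Cons.prems by (auto simp: deg_def)
  then have "(\<Sum>u\<in>{1..Suc n}. deg (mset (map (Upair (Suc n)) (v # vs))) u) =
      1 + (if v \<in> {1..Suc n} then 1 else 0) +
      (\<Sum>u\<in>{1..Suc n}. deg (mset (map (Upair (Suc n)) vs)) u)"
    by (simp only: sum.distrib) (simp add: sum.delta)
  then show ?case using Cons by simp
qed

lemma PA_support: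
  assumes "m \<ge> 1" "n \<ge> 1" "G \<in> set_pmf (PA m n)"
  shows "(\<Sum>u\<in>{1..n}. deg G u) = 2 * m * n - m \<and> (\<forall>e\<in>#G. set_uprod e \<subseteq> {1..n})"
  using assms
proof (induction m n arbitrary: G rule: PA.induct)
  case (1 m)
  then show ?case by simp
next
  case (2 m)
  have "filter_mset (\<lambda>e. Suc 0 \<in> set_uprod e) (replicate_mset m (Upair (Suc 0) (Suc 0))) =
      replicate_mset m (Upair (Suc 0) (Suc 0))"
    by (induction m) auto
  then show ?case using 2 by (auto simp: deg_def)
next
  case (3 m n)
  from 3(4) obtain H vs where H: "H \<in> set_pmf (PA m (Suc n))"
    and vs: "vs \<in> set_pmf (replicate_pmf m (choice_pmf (Suc n) H))"
    and G: "G = H + mset (map (Upair (Suc (Suc n))) vs)"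
    by auto
  have IH: "(\<Sum>u\<in>{1..Suc n}. deg H u) = 2 * m * Suc n - m"
    "\<forall>e\<in>#H. set_uprod e \<subseteq> {1..Suc n}"
    using 3(1)[OF 3(2) _ H] by auto
  have pos: "(\<Sum>u\<in>{1..Suc n}. deg H u) > 0"
    using IH(1) 3(2) by (simp only:) simp
  have "set_pmf (choice_pmf (Suc n) H) \<subseteq> {1..Suc n}"
    by (auto simp: set_pmf_iff pmf_choice_pmf[OF pos] split: if_splits)
  with vs have vs': "set vs \<subseteq> {1..Suc n}" "length vs = m"
    by (auto simp: set_replicate_pmf)
  have "deg H (Suc (Suc n)) = 0"
    using IH(2) by (fastforce simp: deg_def filter_mset_eq_conv)
  then have "(\<Sum>u\<in>{1..Suc (Suc n)}. deg G u) = (2 * m * Suc n - m) + 2 * m"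
    using sum_deg_star[OF vs'(1)] IH(1) vs'(2)
    by (simp add: G deg_add sum.distrib)
  moreover have "\<forall>e\<in>#G. set_uprod e \<subseteq> {1..Suc (Suc n)}"
    using IH(2) vs'(1) by (fastforce simp: G)
  ultimately show ?case by (simp add: algebra_simps)
qed

corollary pmf_choice_pmf_PA:
  assumes "m \<ge> 1" "n \<ge> 1" "G \<in> set_pmf (PA m n)" "w \<in> {1..n}"
  shows "pmf (choice_pmf n G) w = real (deg G w) / real (2 * m * n - m)"
proof -
  have "2 * m * n - m > 0" using assms(1,2) by (cases n) auto
  with pmf_choice_pmf[of G n w] PA_support[OF assms(1-3)] assms(4) show ?thesis by simp
qed

end

theory Submission
  imports Defs
begin

text \<open>
  The \<^emph>\<open>parents\<close> of \<open>v\<close> are the older ends, with multiplicity, of the edges joining \<open>v\<close> to older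
  vertices; every vertex \<open>v \<ge> 2\<close> has \<open>m\<close> of them.  Let \<open>\<pi>\<close> be a nontrivial automorphism and \<open>v\<close> the oldest
  vertex that it moves.  Then \<open>v \<ge> 2\<close>, because vertex \<open>1\<close> is the only one with loops; \<open>w = \<pi> v\<close> is
  younger than \<open>v\<close>; and since \<open>\<pi>\<close> fixes everything older than \<open>v\<close>, all parents of \<open>v\<close> are parents
  of \<open>w\<close> with at least the same multiplicity.  Both have \<open>m\<close> parents, so \<open>v\<close> and \<open>w\<close> have the same
  parents, and of course the same degree (\<open>automorphism_symmetric_pair\<close>).  It remains to show that
  such pairs are unlikely.  Fix a threshold \<open>s\<close>, a small power of \<open>n\<close>.

  If \<open>w > s\<close>, equal parents are already unlikely.  Write \<open>D(p)\<close> for the degree of \<open>p\<close> plus \<open>2m\<close>.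
  Given the graph on \<open>w - 1\<close> vertices, \<open>w\<close> picks the parents of \<open>v\<close> with probability at most a
  constant times \<open>w\<^sup>-\<^sup>m\<close> times the product of \<open>D(p)\<close> over the parents \<open>p\<close> of \<open>v\<close>.
  A product of at most \<open>2m\<close> factors \<open>D\<close> is multiplied on average by at most \<open>exp (r / (2 n - 1))\<close>
  when vertex \<open>n + 1\<close> is added, where \<open>r\<close> is the number of factors, so that each factor grows like
  a square root of time: from time \<open>v\<close> to time \<open>w\<close> the product over the parents gains
  \<open>(w / v)\<close> to the power \<open>m / 2\<close>.  When \<open>v\<close> arrives, it chooses
  independent size-biased parents, so that the product is on average a moment of
  the sum of \<open>D\<^sup>2\<close> over all vertices divided by \<open>v\<close>, which exceeds a constant by logarithmic factors
  only.  Altogether \<open>v\<close> and \<open>w\<close> have equal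
  parents with probability of order \<open>(v w)\<close> to the power \<open>- m / 2\<close> up to logarithms
  (\<open>prob_same_parents\<close>), and for \<open>m \<ge> 3\<close> the sum of this over \<open>w > s\<close> and \<open>v < w\<close> is a negative
  power of \<open>s\<close>.

  If \<open>w \<le> s\<close>, equal degrees are unlikely, because the degrees of two old vertices spread out: the
  largest atom of the joint law of \<open>(deg v, deg w)\<close> is multiplied by at most
  \<open>(2 n - 1) / (2 n + 1)\<close> in each step (\<open>degree_pair_atom_step\<close>), so that it is of order \<open>s / n\<close> at
  time \<open>n\<close>.  This contraction comes from a variant of Abel's binomial identity
  (\<open>abel_sum_eq\<close>), which evaluates the total weight with which the states at one time contribute to
  a given state at the next.  Degrees are of order at most \<open>\<surd>n\<close> on average, so at most \<open>n\<close> to the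
  power \<open>3/4\<close> diagonal atoms
  matter, and the degrees agree with probability of order \<open>s\<close> times \<open>n\<close> to the power \<open>- 1/4\<close>
  (\<open>prob_same_degree\<close>).  There are at most \<open>s\<^sup>2\<close> such pairs; taking \<open>s\<close> of order \<open>n\<close> to the power
  \<open>1/24\<close> makes both contributions negative powers of \<open>n\<close>.
\<close>

section \<open>Growing the graph by one vertex\<close>

definition attach :: "nat \<Rightarrow> multigraph \<Rightarrow> nat list \<Rightarrow> multigraph" where
  "attach n G vs = G + mset (map (Upair (Suc n)) vs)"

definition choices :: "nat \<Rightarrow> nat \<Rightarrow> multigraph \<Rightarrow> nat list pmf" where
  "choices m n G = replicate_pmf m (choice_pmf n G)"

text \<open>
  Multiplicities are read off the graph below \<open>v\<close>, so the loops at vertex \<open>1\<close> are not counted and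
  the result does not change when younger vertices arrive.
\<close>

definition parents :: "multigraph \<Rightarrow> nat \<Rightarrow> nat multiset" where
  "parents G v = (\<Sum>u\<in>{1..<v}. replicate_mset (num_edges G u v) u)"

text \<open>
  The deterministic invariants of the growth process: everything about a possible outcome that the
  probabilistic estimates and the analysis of automorphisms rely on.
\<close>

definition pa_graph :: "nat \<Rightarrow> nat \<Rightarrow> multigraph \<Rightarrow> bool" where
  "pa_graph m n G \<longleftrightarrow>
     (\<forall>e\<in>#G. set_uprod e \<subseteq> {1..n}) \<and>
     (\<Sum>u\<in>{1..n}. deg G u) = 2 * m * n - m \<and>
     (\<forall>v\<in>{1..n}. m \<le> deg G v) \<and>
     num_edges G 1 1 = m \<and>
     (\<forall>v\<in>{2..n}. num_edges G v v = 0 \<and> size (parents G v) = m)"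

lemma count_parents: "count (parents G v) u = (if u \<in> {1..<v} then num_edges G u v else 0)"
proof -
  have "count (parents G v) u = (\<Sum>x\<in>{1..<v}. if x = u then num_edges G x v else 0)"
    unfolding parents_def count_sum by (intro sum.cong) auto
  then show ?thesis by (simp add: sum.delta)
qed

lemma set_parents: "set_mset (parents G v) \<subseteq> {1..<v}"
proof
  fix u assume "u \<in># parents G v"
  then have "count (parents G v) u > 0" by simp
  then show "u \<in> {1..<v}" unfolding count_parents by (auto split: if_splits)
qed

lemma num_edges_star: "num_edges (mset (map (Upair v) vs)) x y =
    (if x = v then count (mset vs) y else if y = v then count (mset vs) x else 0)"
  unfolding num_edges_def by (induction vs) auto

lemma num_edges_attach: "num_edges (attach n G vs) x y = num_edges G x y +
    (if x = Suc n then count (mset vs) y else if y = Suc n then count (mset vs) x else 0)"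
  unfolding attach_def num_edges_star[symmetric] by (simp add: num_edges_def)

lemma num_edges_outside:
  assumes "\<forall>e\<in>#G. set_uprod e \<subseteq> {1..n}" "x \<notin> {1..n} \<or> y \<notin> {1..n}"
  shows "num_edges G x y = 0"
  using assms unfolding num_edges_def by (fastforce simp: count_eq_zero_iff)

lemma deg_outside:
  assumes "\<forall>e\<in>#G. set_uprod e \<subseteq> {1..n}" "v \<notin> {1..n}"
  shows "deg G v = 0"
  using assms unfolding deg_def by (fastforce simp: filter_mset_eq_conv)

lemma deg_star:
  assumes "set vs \<subseteq> {1..n}"
  shows "deg (mset (map (Upair (Suc n)) vs)) u =
     (if u = Suc n then length vs else count (mset vs) u)"
  using assms by (induction vs) (auto simp: deg_def)

lemma deg_attach:
  assumes "set vs \<subseteq> {1..n}" "u \<in> {1..n}"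
  shows "deg (attach n G vs) u = deg G u + count (mset vs) u"
  using assms by (auto simp: attach_def deg_add deg_star simp del: mset_map)

lemma deg_attach_new:
  assumes "set vs \<subseteq> {1..n}" "\<forall>e\<in>#G. set_uprod e \<subseteq> {1..n}"
  shows "deg (attach n G vs) (Suc n) = length vs"
  using deg_outside[OF assms(2), of "Suc n"] assms
  by (simp add: attach_def deg_add deg_star del: mset_map)

lemma parents_attach:
  assumes "v \<le> n"
  shows "parents (attach n G vs) v = parents G v"
  using assms by (auto simp: multiset_eq_iff count_parents num_edges_attach)

lemma parents_attach_new:
  assumes "set vs \<subseteq> {1..n}" "\<forall>e\<in>#G. set_uprod e \<subseteq> {1..n}"
  shows "parents (attach n G vs) (Suc n) = mset vs"
proof -
  have "num_edges G u (Suc n) = 0" for u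
    using num_edges_outside[OF assms(2)] by simp
  moreover have "count (mset vs) u = 0" if "\<not> (1 \<le> u \<and> u < Suc n)" for u
    using that assms(1) by (auto simp: count_eq_zero_iff)
  ultimately show ?thesis
    by (auto simp: multiset_eq_iff count_parents num_edges_attach)
qed

lemma pa_graph_attach:
  assumes G: "pa_graph m n G" and n: "n \<ge> 1" and vs: "set vs \<subseteq> {1..n}" "length vs = m"
  shows "pa_graph m (Suc n) (attach n G vs)"
proof -
  have edges: "\<forall>e\<in>#G. set_uprod e \<subseteq> {1..n}"
    using G by (simp add: pa_graph_def)
  have "(\<Sum>u\<in>{1..Suc n}. deg (attach n G vs) u) =
      (\<Sum>u\<in>{1..Suc n}. deg G u) + (\<Sum>u\<in>{1..Suc n}. deg (mset (map (Upair (Suc n)) vs)) u)"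
    by (simp add: attach_def deg_add sum.distrib)
  also have "\<dots> = (2 * m * n - m) + 2 * m"
    using sum_deg_star[OF vs(1)] deg_outside[OF edges, of "Suc n"] vs(2) G
    by (simp add: pa_graph_def)
  also have "\<dots> = 2 * m * Suc n - m"
    using n by (cases n) (simp_all add: algebra_simps)
  finally have sum: "(\<Sum>u\<in>{1..Suc n}. deg (attach n G vs) u) = 2 * m * Suc n - m" .
  have "\<forall>e\<in>#attach n G vs. set_uprod e \<subseteq> {1..Suc n}"
    using edges vs(1) by (fastforce simp: attach_def)
  moreover have "m \<le> deg (attach n G vs) v" if "v \<in> {1..Suc n}" for v
  proof (cases "v = Suc n")
    case True
    then show ?thesis using deg_attach_new[OF vs(1) edges] vs(2) by simp
  next
    case False
    then have "v \<in> {1..n}" using that by auto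
    then show ?thesis using deg_attach[OF vs(1), of v G] G by (force simp: pa_graph_def)
  qed
  moreover have "num_edges (attach n G vs) 1 1 = m"
    using G n by (simp add: num_edges_attach pa_graph_def)
  moreover have "num_edges (attach n G vs) v v = 0 \<and> size (parents (attach n G vs) v) = m"
    if "v \<in> {2..Suc n}" for v
  proof (cases "v = Suc n")
    case True
    have "count (mset vs) (Suc n) = 0"
      using vs(1) by (auto simp: count_eq_zero_iff)
    then show ?thesis
      using True parents_attach_new[OF vs(1) edges] vs(2) num_edges_outside[OF edges]
      by (simp add: num_edges_attach)
  next
    case False
    then show ?thesis using that G by (simp add: num_edges_attach parents_attach pa_graph_def)
  qed
  ultimately show ?thesis using sum by (simp add: pa_graph_def)
qed

lemma PA_Suc:
  assumes "n \<ge> 1"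
  shows "PA m (Suc n) = bind_pmf (PA m n) (\<lambda>G. map_pmf (attach n G) (choices m n G))"
  using assms by (cases n) (simp_all add: attach_def[abs_def] choices_def)

lemma pmf_choice_pmf_graph:
  assumes "pa_graph m n G" "m \<ge> 1" "n \<ge> 1"
  shows "pmf (choice_pmf n G) w =
    (if w \<in> {1..n} then real (deg G w) / real (2 * m * n - m) else 0)"
proof -
  have "2 * m * n - m > 0" using assms(2,3) by (cases n) auto
  with pmf_choice_pmf[of G n w] assms(1) show ?thesis by (simp add: pa_graph_def)
qed

lemma set_choice_pmf:
  assumes "pa_graph m n G" "m \<ge> 1" "n \<ge> 1"
  shows "set_pmf (choice_pmf n G) \<subseteq> {1..n}"
  by (auto simp: set_pmf_iff pmf_choice_pmf_graph[OF assms] split: if_splits)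

lemma set_choices:
  assumes "pa_graph m n G" "m \<ge> 1" "n \<ge> 1" "vs \<in> set_pmf (choices m n G)"
  shows "set vs \<subseteq> {1..n}" "length vs = m"
  using assms(4) set_choice_pmf[OF assms(1-3)] by (auto simp: choices_def set_replicate_pmf)

lemma finite_set_replicate_pmf:
  assumes "finite (set_pmf p)"
  shows "finite (set_pmf (replicate_pmf k p))"
proof -
  have "set_pmf (replicate_pmf k p) = {xs. set xs \<subseteq> set_pmf p \<and> length xs = k}"
    by (auto simp: set_replicate_pmf)
  then show ?thesis using finite_lists_length_eq[OF assms] by simp
qed

lemma finite_choice_pmf:
  assumes "pa_graph m n G" "m \<ge> 1" "n \<ge> 1"
  shows "finite (set_pmf (choice_pmf n G))"
  using set_choice_pmf[OF assms] finite_subset by blast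

lemma finite_choices:
  assumes "pa_graph m n G" "m \<ge> 1" "n \<ge> 1"
  shows "finite (set_pmf (choices m n G))"
  unfolding choices_def by (intro finite_set_replicate_pmf finite_choice_pmf[OF assms])

lemma deg_loops: "deg (replicate_mset m (Upair v v)) v = m"
  unfolding deg_def by (induction m) auto

lemma pa_graph_PA:
  assumes "m \<ge> 1" "n \<ge> 1" "G \<in> set_pmf (PA m n)"
  shows "pa_graph m n G"
  using assms(2,3)
proof (induction n arbitrary: G rule: nat_induct_at_least)
  case base
  show ?case using base deg_loops[of m 1]
    by (auto simp: pa_graph_def num_edges_def)
next
  case (Suc n)
  then obtain H vs where H: "H \<in> set_pmf (PA m n)" and vs: "vs \<in> set_pmf (choices m n H)"
    and G: "G = attach n H vs"
    by (auto simp: PA_Suc)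
  from Suc.IH[OF H] show ?case
    using pa_graph_attach set_choices[OF _ assms(1) Suc.hyps vs] Suc.hyps G by blast
qed

lemma finite_PA:
  assumes "m \<ge> 1" "n \<ge> 1"
  shows "finite (set_pmf (PA m n))"
  using assms(2)
proof (induction n rule: nat_induct_at_least)
  case base
  show ?case by simp
next
  case (Suc n)
  then show ?case
    using finite_choices[OF pa_graph_PA[OF assms(1) Suc.hyps] assms(1) Suc.hyps]
    by (auto simp: PA_Suc)
qed

section \<open>Expectations over finitely supported distributions\<close>

lemma expectation_mono:
  fixes f g :: "'a \<Rightarrow> real"
  assumes "finite (set_pmf p)" "\<And>x. x \<in> set_pmf p \<Longrightarrow> f x \<le> g x"
  shows "measure_pmf.expectation p f \<le> measure_pmf.expectation p g"
  using assms by (intro integral_mono_AE integrable_measure_pmf_finite) (auto simp: AE_measure_pmf_iff)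

lemma expectation_cong:
  fixes f g :: "'a \<Rightarrow> real"
  assumes "\<And>x. x \<in> set_pmf p \<Longrightarrow> f x = g x"
  shows "measure_pmf.expectation p f = measure_pmf.expectation p g"
  using assms by (intro integral_cong_AE) (auto simp: AE_measure_pmf_iff)

lemma expectation_bind:
  fixes h :: "'b \<Rightarrow> real"
  assumes "finite (set_pmf p)" "\<And>x. x \<in> set_pmf p \<Longrightarrow> finite (set_pmf (f x))"
  shows "measure_pmf.expectation (bind_pmf p f) h =
    measure_pmf.expectation p (\<lambda>x. measure_pmf.expectation (f x) h)"
proof -
  have "measure_pmf.expectation p (\<lambda>x. measure_pmf.expectation (f x) h) =
      (\<Sum>a\<in>set_pmf p. pmf p a * measure_pmf.expectation (f a) h)"
    using assms(1) by (subst integral_measure_pmf[of "set_pmf p"]) auto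
  then show ?thesis
    using pmf_expectation_bind[of "set_pmf p" f p h] assms by simp
qed

lemma prob_expectation:
  "measure_pmf.prob p {x. Q x} = measure_pmf.expectation p (\<lambda>x. of_bool (Q x))"
proof -
  have "(\<lambda>x. of_bool (Q x)) = (indicator {x. Q x} :: _ \<Rightarrow> real)"
    by (auto simp: indicator_def)
  then show ?thesis by simp
qed

lemma expectation_sum:
  fixes f :: "'i \<Rightarrow> 'a \<Rightarrow> real"
  assumes "finite (set_pmf p)"
  shows "measure_pmf.expectation p (\<lambda>x. \<Sum>i\<in>I. f i x) =
    (\<Sum>i\<in>I. measure_pmf.expectation p (f i))"
  by (intro Bochner_Integration.integral_sum integrable_measure_pmf_finite assms)

lemma prob_cong_support:
  assumes "\<And>x. x \<in> set_pmf p \<Longrightarrow> P x \<longleftrightarrow> Q x"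
  shows "measure_pmf.prob p {x. P x} = measure_pmf.prob p {x. Q x}"
  unfolding prob_expectation using assms by (intro expectation_cong) auto

lemma prob_mono_support:
  assumes "finite (set_pmf p)" "\<And>x. x \<in> set_pmf p \<Longrightarrow> P x \<Longrightarrow> Q x"
  shows "measure_pmf.prob p {x. P x} \<le> measure_pmf.prob p {x. Q x}"
  unfolding prob_expectation using assms by (intro expectation_mono) auto

lemma prob_Ex_le:
  assumes "finite (set_pmf p)" "finite I"
  shows "measure_pmf.prob p {x. \<exists>i\<in>I. P i x} \<le> (\<Sum>i\<in>I. measure_pmf.prob p {x. P i x})"
proof -
  have "{x. \<exists>i\<in>I. P i x} = (\<Union>i\<in>I. {x. P i x})" by auto
  then show ?thesis
    using measure_pmf.finite_measure_subadditive_finite[of I "\<lambda>i. {x. P i x}" p] assms(2) by simp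
qed

text \<open>
  One step of the process.  Every estimate below goes by induction on time through this equation.
\<close>

lemma expectation_PA_Suc:
  fixes h :: "multigraph \<Rightarrow> real"
  assumes "m \<ge> 1" "n \<ge> 1"
  shows "measure_pmf.expectation (PA m (Suc n)) h =
    measure_pmf.expectation (PA m n)
      (\<lambda>G. measure_pmf.expectation (choices m n G) (\<lambda>vs. h (attach n G vs)))"
  using finite_PA[OF assms] finite_choices[OF pa_graph_PA[OF assms] assms]
  by (simp add: PA_Suc[OF assms(2)] expectation_bind)

lemma expectation_replicate_Suc:
  fixes h :: "'a list \<Rightarrow> real"
  assumes "finite (set_pmf p)"
  shows "measure_pmf.expectation (replicate_pmf (Suc k) p) h =
    measure_pmf.expectation p (\<lambda>x. measure_pmf.expectation (replicate_pmf k p) (\<lambda>xs. h (x # xs)))"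
  using assms finite_set_replicate_pmf[OF assms, of k]
  by (simp add: replicate_pmf.simps map_pmf_def[symmetric] expectation_bind)

section \<open>Moments of the degrees\<close>

text \<open>
  The factor by which a single degree grows on average between time \<open>1\<close> and time \<open>t\<close>, up to a constant
  factor.  Keeping this product form makes the induction steps exact; it lies between
  \<open>\<surd>t\<close> and a constant multiple of \<open>\<surd>t\<close>.
\<close>

definition growth :: "nat \<Rightarrow> real" where
  "growth t = exp (\<Sum>s\<in>{1..<t}. 1 / (2 * real s - 1))"

text \<open>
  Raising a factor of a product with multiplicity \<open>k\<close> from \<open>b\<close> to \<open>b + 1\<close> costs more than the linear
  term \<open>k / b\<close>.  Shifting degrees by a constant absorbs the excess: the choice is made with
  probability proportional to the unshifted degree, which is smaller.  The shift \<open>2 * m\<close> suffices for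
  products of up to \<open>2 * m\<close> factors.
\<close>

definition shifted_deg :: "nat \<Rightarrow> multigraph \<Rightarrow> nat \<Rightarrow> real" where
  "shifted_deg m G p = real (deg G p) + 2 * real m"

text \<open>
  Bernoulli's inequality for \<open>(1 - 1 / (b + 1)) ^ k\<close>.
\<close>

lemma power_succ_le:
  fixes b d :: real
  assumes "d > 0" "b \<ge> 0" "b + 1 \<ge> d + real k"
  shows "(b + 1) ^ k \<le> b ^ k * (1 + real k / d)"
proof -
  have "1 + real k * (- (1 / (b + 1))) \<le> (1 + - (1 / (b + 1))) ^ k"
    using assms by (intro Bernoulli_inequality) (simp add: field_simps)
  also have "1 + - (1 / (b + 1)) = b / (b + 1)"
    using assms by (simp add: field_simps)
  finally have "(b + 1 - real k) / (b + 1) \<le> b ^ k / (b + 1) ^ k"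
    using assms by (simp add: field_simps power_divide)
  moreover have "d / (d + real k) \<le> (b + 1 - real k) / (b + 1)"
  proof -
    have "0 \<le> real k * (b + 1 - d - real k)"
      using assms by (intro mult_nonneg_nonneg) auto
    then show ?thesis using assms by (simp add: field_simps)
  qed
  ultimately have "d / (d + real k) \<le> b ^ k / (b + 1) ^ k" by linarith
  moreover have "(b + 1) ^ k > 0" using assms by simp
  ultimately have "d * (b + 1) ^ k \<le> b ^ k * (d + real k)"
    using assms by (simp add: field_simps)
  then show ?thesis using assms by (simp add: field_simps)
qed

lemma prod_mset_nonneg_real:
  fixes f :: "'a \<Rightarrow> real"
  assumes "\<And>x. x \<in># M \<Longrightarrow> f x \<ge> 0"
  shows "(\<Prod>x\<in>#M. f x) \<ge> 0"
  using assms by (induction M) auto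

lemma prod_mset_mono_real:
  fixes f g :: "'a \<Rightarrow> real"
  assumes "\<And>x. x \<in># M \<Longrightarrow> 0 \<le> f x \<and> f x \<le> g x"
  shows "(\<Prod>x\<in>#M. f x) \<le> (\<Prod>x\<in>#M. g x)"
  using assms
proof (induction M)
  case (add x M)
  then show ?case
    by (auto intro!: mult_mono prod_mset_nonneg_real intro: order_trans)
qed auto

lemma prod_mset_divide_real:
  fixes f g :: "'a \<Rightarrow> real"
  shows "(\<Prod>x\<in>#M. f x / g x) = (\<Prod>x\<in>#M. f x) / (\<Prod>x\<in>#M. g x)"
  by (induction M) auto

lemma prod_mset_const: "(\<Prod>x\<in>#M. (c::real)) = c ^ size M"
  by (induction M) auto

lemma prod_mset_bump:
  fixes b :: "nat \<Rightarrow> real"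
  assumes "d > 0" "b u \<ge> 0" "b u + 1 \<ge> d + real (count M u)" "\<And>p. p \<in># M \<Longrightarrow> b p \<ge> 0"
  shows "(\<Prod>p\<in>#M. b p + of_bool (p = u)) \<le> (\<Prod>p\<in>#M. b p) * (1 + real (count M u) / d)"
proof -
  define N where "N = filter_mset (\<lambda>p. p \<noteq> u) M"
  have M: "M = replicate_mset (count M u) u + N"
    by (auto simp: multiset_eq_iff N_def)
  have N: "(\<Prod>p\<in>#N. b p + of_bool (p = u)) = (\<Prod>p\<in>#N. b p)"
    unfolding N_def by (intro arg_cong[where f = prod_mset] image_mset_cong) auto
  have pos: "(\<Prod>p\<in>#N. b p) \<ge> 0"
    using assms(4) by (intro prod_mset_nonneg_real) (auto simp: N_def)
  have "(\<Prod>p\<in>#M. b p + of_bool (p = u)) = (b u + 1) ^ count M u * (\<Prod>p\<in>#N. b p)"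
    by (subst M) (simp add: N)
  also have "\<dots> \<le> (b u ^ count M u * (1 + real (count M u) / d)) * (\<Prod>p\<in>#N. b p)"
    using power_succ_le[OF assms(1-3)] pos by (intro mult_right_mono)
  also have "\<dots> = (\<Prod>p\<in>#M. b p) * (1 + real (count M u) / d)"
    by (subst (2) M) simp
  finally show ?thesis .
qed

lemma size_eq_sum_count:
  assumes "finite A" "set_mset M \<subseteq> A"
  shows "size M = (\<Sum>u\<in>A. count M u)"
  unfolding size_multiset_overloaded_eq
  using assms by (intro sum.mono_neutral_left) (auto simp: count_eq_zero_iff)

text \<open>
  Choosing \<open>u\<close>, with probability \<open>d u / T\<close>, multiplies the product by at most
  \<open>1 + count M u / d u\<close>.  The degree cancels, and the expected gain \<open>size M / T\<close> depends on
  the number of factors only.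
\<close>

lemma expectation_choice_product:
  fixes b d :: "nat \<Rightarrow> real"
  assumes A: "finite A" and q: "\<And>u. pmf q u = (if u \<in> A then d u / T else 0)" and T: "T > 0"
    and d: "\<And>u. u \<in> A \<Longrightarrow> d u > 0"
    and M: "set_mset M \<subseteq> A" and b: "\<And>u. u \<in> A \<Longrightarrow> b u + 1 \<ge> d u + real (size M)"
    and b0: "\<And>u. u \<in> A \<Longrightarrow> b u \<ge> 0"
  shows "measure_pmf.expectation q (\<lambda>u. \<Prod>p\<in>#M. b p + of_bool (p = u))
    \<le> (\<Prod>p\<in>#M. b p) * (1 + real (size M) / T)"
proof -
  have set_q: "set_pmf q \<subseteq> A"
    by (auto simp: set_pmf_iff q split: if_splits)
  have "(\<Sum>u\<in>A. pmf q u) = 1"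
    using A set_q by (rule sum_pmf_eq_1)
  then have sum1: "(\<Sum>u\<in>A. d u / T) = 1" by (simp add: q)
  have "measure_pmf.expectation q (\<lambda>u. \<Prod>p\<in>#M. b p + of_bool (p = u)) =
      (\<Sum>u\<in>A. pmf q u * (\<Prod>p\<in>#M. b p + of_bool (p = u)))"
    using A set_q by (subst integral_measure_pmf[of A]) auto
  also have "\<dots> \<le> (\<Sum>u\<in>A. d u / T * ((\<Prod>p\<in>#M. b p) * (1 + real (count M u) / d u)))"
  proof (intro sum_mono)
    fix u assume u: "u \<in> A"
    have "count M u \<le> size M" by (rule count_le_size)
    then have "b u + 1 \<ge> d u + real (count M u)" using b[OF u] by simp
    then have "(\<Prod>p\<in>#M. b p + of_bool (p = u)) \<le> (\<Prod>p\<in>#M. b p) * (1 + real (count M u) / d u)"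
      using M b0 by (intro prod_mset_bump d b0 u) auto
    then show "pmf q u * (\<Prod>p\<in>#M. b p + of_bool (p = u)) \<le>
        d u / T * ((\<Prod>p\<in>#M. b p) * (1 + real (count M u) / d u))"
      using u d[OF u] T unfolding q by (simp only: if_True) (intro mult_left_mono, auto)
  qed
  also have "\<dots> = (\<Sum>u\<in>A. (\<Prod>p\<in>#M. b p) * (d u / T + real (count M u) / T))"
    using d T by (intro sum.cong refl) (force simp: field_simps)
  also have "\<dots> = (\<Prod>p\<in>#M. b p) * (1 + real (size M) / T)"
    unfolding sum_distrib_left[symmetric] sum.distrib sum1 size_eq_sum_count[OF A M] of_nat_sum
      sum_divide_distrib ..
  finally show ?thesis .
qed

text \<open>
  The choices of one new vertex all refer to the same degrees \<open>d\<close>, while the factors \<open>b\<close> increase from one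
  choice to the next; hence the hypothesis on \<open>b\<close> is an inequality, which further choices
  preserve.
\<close>

lemma expectation_choices_product:
  fixes b d :: "nat \<Rightarrow> real"
  assumes A: "finite A" and q: "\<And>u. pmf q u = (if u \<in> A then d u / T else 0)" and T: "T > 0"
    and d: "\<And>u. u \<in> A \<Longrightarrow> d u > 0" and M: "set_mset M \<subseteq> A"
    and b: "\<And>u. u \<in> A \<Longrightarrow> b u + 1 \<ge> d u + real (size M)"
    and b0: "\<And>u. u \<in> A \<Longrightarrow> b u \<ge> 0"
  shows "measure_pmf.expectation (replicate_pmf k q)
      (\<lambda>vs. \<Prod>p\<in>#M. b p + real (count (mset vs) p))
    \<le> (\<Prod>p\<in>#M. b p) * (1 + real (size M) / T) ^ k"
  using b b0
proof (induction k arbitrary: b)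
  case 0
  then show ?case by simp
next
  case (Suc k)
  have "set_pmf q \<subseteq> A" by (auto simp: set_pmf_iff q split: if_splits)
  then have fin: "finite (set_pmf q)" using A finite_subset by blast
  let ?c = "(1 + real (size M) / T) ^ k"
  have "measure_pmf.expectation (replicate_pmf (Suc k) q)
        (\<lambda>vs. \<Prod>p\<in>#M. b p + real (count (mset vs) p)) =
      measure_pmf.expectation q (\<lambda>u. measure_pmf.expectation (replicate_pmf k q)
        (\<lambda>vs. \<Prod>p\<in>#M. (b p + of_bool (p = u)) + real (count (mset vs) p)))"
    unfolding expectation_replicate_Suc[OF fin]
    by (intro expectation_cong arg_cong[where f = prod_mset] image_mset_cong) auto
  also have "\<dots> \<le> measure_pmf.expectation q (\<lambda>u. (\<Prod>p\<in>#M. b p + of_bool (p = u)) * ?c)"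
  proof (intro expectation_mono fin Suc.IH)
    fix u v assume "v \<in> A"
    then show "d v + real (size M) \<le> b v + of_bool (v = u) + 1" "0 \<le> b v + of_bool (v = u)"
      using Suc.prems[of v] by auto
  qed
  also have "\<dots> = measure_pmf.expectation q (\<lambda>u. (\<Prod>p\<in>#M. b p + of_bool (p = u))) * ?c"
    by simp
  also have "\<dots> \<le> ((\<Prod>p\<in>#M. b p) * (1 + real (size M) / T)) * ?c"
    using T Suc.prems
    by (intro mult_right_mono expectation_choice_product[OF A q T d M]) auto
  finally show ?case by simp
qed

lemma growth_pos [simp]: "growth t > 0"
  by (simp add: growth_def)

lemma growth_nonzero [simp]: "growth t \<noteq> 0"
  by (simp add: growth_def)

lemma growth_Suc: "n \<ge> 1 \<Longrightarrow> growth (Suc n) = growth n * exp (1 / (2 * real n - 1))"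
  unfolding growth_def by (simp add: sum.atLeastLessThan_Suc exp_add)

lemma shifted_deg_pos: "m \<ge> 1 \<Longrightarrow> shifted_deg m G p \<ge> 1"
  by (simp add: shifted_deg_def)

lemma shifted_deg_attach:
  assumes "set vs \<subseteq> {1..n}" "u \<in> {1..n}"
  shows "shifted_deg m (attach n G vs) u = shifted_deg m G u + real (count (mset vs) u)"
  using deg_attach[OF assms] by (simp add: shifted_deg_def)

lemma total_degree_real: "n \<ge> 1 \<Longrightarrow> real (2 * m * n - m) = real m * (2 * real n - 1)"
  by (cases n) (simp_all add: of_nat_diff algebra_simps)

lemma expectation_attach_product:
  assumes G: "pa_graph m n G" and m: "m \<ge> 1" and n: "n \<ge> 1"
    and M: "set_mset M \<subseteq> {1..n}" "size M \<le> 2 * m"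
  shows "measure_pmf.expectation (choices m n G) (\<lambda>vs. \<Prod>p\<in>#M. shifted_deg m (attach n G vs) p)
    \<le> (\<Prod>p\<in>#M. shifted_deg m G p) * (growth (Suc n) / growth n) ^ size M"
proof -
  define T where "T = real m * (2 * real n - 1)"
  have T: "T > 0" using m n by (simp add: T_def)
  have q: "pmf (choice_pmf n G) u = (if u \<in> {1..n} then real (deg G u) / T else 0)" for u
    unfolding pmf_choice_pmf_graph[OF G m n] total_degree_real[OF n] T_def by simp
  have degpos: "real (deg G u) > 0" if "u \<in> {1..n}" for u
    using G that m by (force simp: pa_graph_def)
  have "measure_pmf.expectation (choices m n G) (\<lambda>vs. \<Prod>p\<in>#M. shifted_deg m (attach n G vs) p) =
      measure_pmf.expectation (choices m n G) (\<lambda>vs. \<Prod>p\<in>#M. shifted_deg m G p + real (count (mset vs) p))"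
    using M(1) set_choices(1)[OF G m n]
    by (intro expectation_cong arg_cong[where f = prod_mset] image_mset_cong shifted_deg_attach) blast+
  also have "\<dots> \<le> (\<Prod>p\<in>#M. shifted_deg m G p) * (1 + real (size M) / T) ^ m"
    unfolding choices_def using M(2)
    by (intro expectation_choices_product[OF _ q T degpos M(1)]) (auto simp: shifted_deg_def)
  also have "(1 + real (size M) / T) ^ m \<le> exp (real (size M) / T) ^ m"
    using T by (intro power_mono exp_ge_add_one_self) auto
  also have "\<dots> = exp (1 / (2 * real n - 1)) ^ size M"
    using m by (simp add: exp_of_nat_mult[symmetric] T_def)
  also have "exp (1 / (2 * real n - 1)) = growth (Suc n) / growth n"
    using growth_Suc[OF n] by simp
  finally show ?thesis
    using shifted_deg_pos[OF m] by (simp add: mult_left_mono prod_mset_nonneg_real order_trans[OF zero_le_one])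
qed

text \<open>
  Each factor starts at \<open>3 * m\<close> when its vertex is born and then grows like \<open>growth\<close>.  In the
  induction, the copies of the newest vertex are split off as constants.
\<close>

lemma expectation_degree_product:
  assumes m: "m \<ge> 1" and n: "n \<ge> 1" and M: "set_mset M \<subseteq> {1..n}" "size M \<le> 2 * m"
  shows "measure_pmf.expectation (PA m n) (\<lambda>G. \<Prod>p\<in>#M. shifted_deg m G p)
    \<le> (\<Prod>p\<in>#M. 3 * real m * (growth n / growth p))"
  using n M
proof (induction n arbitrary: M rule: nat_induct_at_least)
  case base
  have "M = replicate_mset (size M) 1"
    using base(1) by (metis atLeastAtMost_singleton set_mset_subset_singletonD)
  then obtain k where k: "M = replicate_mset k 1" by blast
  show ?case using deg_loops[of m 1] by (simp add: k shifted_deg_def)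
next
  case (Suc n)
  define c where "c = count M (Suc n)"
  define N where "N = filter_mset (\<lambda>p. p \<noteq> Suc n) M"
  have M: "M = replicate_mset c (Suc n) + N"
    by (auto simp: multiset_eq_iff N_def c_def)
  have N: "set_mset N \<subseteq> {1..n}" "size N \<le> 2 * m"
    using Suc.prems order_trans[OF size_mset_mono[OF multiset_filter_subset[of "\<lambda>p. p \<noteq> Suc n" M]]]
    by (auto simp: N_def le_Suc_eq)
  let ?r = "(growth (Suc n) / growth n) ^ size N"
  have "measure_pmf.expectation (PA m (Suc n)) (\<lambda>G. \<Prod>p\<in>#M. shifted_deg m G p) =
      measure_pmf.expectation (PA m n) (\<lambda>G. measure_pmf.expectation (choices m n G)
        (\<lambda>vs. \<Prod>p\<in>#M. shifted_deg m (attach n G vs) p))"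
    by (rule expectation_PA_Suc[OF m Suc.hyps])
  also have "\<dots> = measure_pmf.expectation (PA m n) (\<lambda>G. (3 * real m) ^ c *
      measure_pmf.expectation (choices m n G) (\<lambda>vs. \<Prod>p\<in>#N. shifted_deg m (attach n G vs) p))"
  proof (intro expectation_cong)
    fix G assume "G \<in> set_pmf (PA m n)"
    then have G: "pa_graph m n G" by (rule pa_graph_PA[OF m Suc.hyps])
    have "(\<Prod>p\<in>#M. shifted_deg m (attach n G vs) p) =
        (3 * real m) ^ c * (\<Prod>p\<in>#N. shifted_deg m (attach n G vs) p)"
      if "vs \<in> set_pmf (choices m n G)" for vs
    proof -
      note vs = set_choices[OF G m Suc.hyps that]
      have "shifted_deg m (attach n G vs) (Suc n) = 3 * real m"
        using deg_attach_new[OF vs(1), of G] G vs(2) by (simp add: shifted_deg_def pa_graph_def)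
      then show ?thesis by (subst M) simp
    qed
    then have "measure_pmf.expectation (choices m n G) (\<lambda>vs. \<Prod>p\<in>#M. shifted_deg m (attach n G vs) p) =
        measure_pmf.expectation (choices m n G)
          (\<lambda>vs. (3 * real m) ^ c * (\<Prod>p\<in>#N. shifted_deg m (attach n G vs) p))"
      by (rule expectation_cong)
    then show "measure_pmf.expectation (choices m n G) (\<lambda>vs. \<Prod>p\<in>#M. shifted_deg m (attach n G vs) p) =
      (3 * real m) ^ c *
      measure_pmf.expectation (choices m n G) (\<lambda>vs. \<Prod>p\<in>#N. shifted_deg m (attach n G vs) p)"
      by simp
  qed
  also have "\<dots> \<le> measure_pmf.expectation (PA m n)
      (\<lambda>G. (3 * real m) ^ c * ((\<Prod>p\<in>#N. shifted_deg m G p) * ?r))"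
    by (intro expectation_mono finite_PA mult_left_mono expectation_attach_product N pa_graph_PA
        m Suc.hyps) auto
  also have "\<dots> = (3 * real m) ^ c * ?r * measure_pmf.expectation (PA m n) (\<lambda>G. \<Prod>p\<in>#N. shifted_deg m G p)"
    by simp
  also have "\<dots> \<le> (3 * real m) ^ c * ?r * (\<Prod>p\<in>#N. 3 * real m * (growth n / growth p))"
    by (intro mult_left_mono Suc.IH N) (auto intro!: mult_nonneg_nonneg zero_le_power
        divide_nonneg_nonneg less_imp_le[OF growth_pos])
  also have "\<dots> = (3 * real m) ^ c * (\<Prod>p\<in>#N. (growth (Suc n) / growth n) * (3 * real m * (growth n / growth p)))"
    by (simp only: prod_mset.distrib prod_mset_const mult.assoc)
  also have "(\<Prod>p\<in>#N. (growth (Suc n) / growth n) * (3 * real m * (growth n / growth p))) =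
      (\<Prod>p\<in>#N. 3 * real m * (growth (Suc n) / growth p))"
    by (intro arg_cong[where f = prod_mset] image_mset_cong)
      simp
  also have "(3 * real m) ^ c * \<dots> = (\<Prod>p\<in>#M. 3 * real m * (growth (Suc n) / growth p))"
    by (subst M) simp
  finally show ?case .
qed

text \<open>
  The power of the sum is expanded one factor at a time, each summand adding two copies of a vertex
  to \<open>M\<close>; the extra product makes the induction work.
\<close>

lemma expectation_square_sum_product:
  assumes m: "m \<ge> 1" and n: "n \<ge> 1" and M: "set_mset M \<subseteq> {1..n}" "2 * k + size M \<le> 2 * m"
  shows "measure_pmf.expectation (PA m n)
      (\<lambda>G. (\<Sum>u\<in>{1..n}. (shifted_deg m G u)\<^sup>2) ^ k * (\<Prod>p\<in>#M. shifted_deg m G p))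
    \<le> (\<Sum>u\<in>{1..n}. (3 * real m * (growth n / growth u))\<^sup>2) ^ k * (\<Prod>p\<in>#M. 3 * real m * (growth n / growth p))"
  using M
proof (induction k arbitrary: M)
  case 0
  then show ?case using expectation_degree_product[OF m n, of M] by simp
next
  case (Suc k)
  define S where "S = (\<lambda>G. \<Sum>u\<in>{1..n}. (shifted_deg m G u)\<^sup>2)"
  define s where "s = (\<Sum>u\<in>{1..n}. (3 * real m * (growth n / growth u))\<^sup>2)"
  define Q where "Q = (\<Prod>p\<in>#M. 3 * real m * (growth n / growth p))"
  have split: "S G ^ Suc k * (\<Prod>p\<in>#M. shifted_deg m G p) =
      (\<Sum>u\<in>{1..n}. S G ^ k * (\<Prod>p\<in>#add_mset u (add_mset u M). shifted_deg m G p))" for G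
  proof -
    have "S G ^ Suc k * (\<Prod>p\<in>#M. shifted_deg m G p) = S G * (S G ^ k * (\<Prod>p\<in>#M. shifted_deg m G p))"
      by simp
    also have "\<dots> = (\<Sum>u\<in>{1..n}. (shifted_deg m G u)\<^sup>2 * (S G ^ k * (\<Prod>p\<in>#M. shifted_deg m G p)))"
      unfolding sum_distrib_right[symmetric] by (simp only: S_def)
    finally show ?thesis by (simp add: power2_eq_square mult_ac)
  qed
  have "measure_pmf.expectation (PA m n) (\<lambda>G. S G ^ Suc k * (\<Prod>p\<in>#M. shifted_deg m G p)) =
      (\<Sum>u\<in>{1..n}. measure_pmf.expectation (PA m n)
        (\<lambda>G. S G ^ k * (\<Prod>p\<in>#add_mset u (add_mset u M). shifted_deg m G p)))"
    unfolding split by (rule expectation_sum[OF finite_PA[OF m n]])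
  also have "\<dots> \<le> (\<Sum>u\<in>{1..n}. s ^ k *
      (\<Prod>p\<in>#add_mset u (add_mset u M). 3 * real m * (growth n / growth p)))"
    unfolding S_def s_def using Suc.prems by (intro sum_mono Suc.IH) auto
  also have "\<dots> = (\<Sum>u\<in>{1..n}. (3 * real m * (growth n / growth u))\<^sup>2 * (s ^ k * Q))"
    by (intro sum.cong refl) (simp add: Q_def power2_eq_square mult_ac)
  also have "\<dots> = s ^ Suc k * Q"
    unfolding sum_distrib_right[symmetric] by (simp add: s_def)
  finally show ?case by (simp only: S_def s_def Q_def)
qed

lemma expectation_replicate_prod:
  fixes f :: "'a \<Rightarrow> real"
  assumes "finite (set_pmf q)"
  shows "measure_pmf.expectation (replicate_pmf k q) (\<lambda>vs. \<Prod>p\<in>#mset vs. f p) =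
    measure_pmf.expectation q f ^ k"
proof (induction k)
  case (Suc k)
  show ?case
    unfolding expectation_replicate_Suc[OF assms] by (simp add: Suc)
qed simp

text \<open>
  Given the old graph, the parents of the new vertex are independent and size-biased, so the expected
  product is a power of the sum of \<open>deg u * shifted_deg u\<close> divided by the total degree.
  The factor \<open>m + 1\<close> pays for the edges that the parents receive from the new vertex.
\<close>

lemma expectation_new_parents:
  assumes m: "m \<ge> 1" and n: "n \<ge> 1"
  shows "measure_pmf.expectation (PA m (Suc n)) (\<lambda>G. \<Prod>p\<in>#parents G (Suc n). shifted_deg m G p)
    \<le> ((real m + 1) / (real m * (2 * real n - 1)) *
        (\<Sum>u\<in>{1..n}. (3 * real m * (growth n / growth u))\<^sup>2)) ^ m"
proof -
  define T where "T = real m * (2 * real n - 1)"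
  have T: "T > 0" using m n by (simp add: T_def)
  define S where "S = (\<lambda>G. \<Sum>u\<in>{1..n}. (shifted_deg m G u)\<^sup>2)"
  have "measure_pmf.expectation (PA m (Suc n)) (\<lambda>G. \<Prod>p\<in>#parents G (Suc n). shifted_deg m G p) =
     measure_pmf.expectation (PA m n) (\<lambda>G. measure_pmf.expectation (choices m n G)
       (\<lambda>vs. \<Prod>p\<in>#parents (attach n G vs) (Suc n). shifted_deg m (attach n G vs) p))"
    by (rule expectation_PA_Suc[OF m n])
  also have "\<dots> \<le> measure_pmf.expectation (PA m n) (\<lambda>G. ((real m + 1) / T * S G) ^ m)"
  proof (intro expectation_mono finite_PA m n)
    fix G assume "G \<in> set_pmf (PA m n)"
    then have G: "pa_graph m n G" by (rule pa_graph_PA[OF m n])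
    note fin = finite_choice_pmf[OF G m n]
    have "measure_pmf.expectation (choices m n G)
        (\<lambda>vs. \<Prod>p\<in>#parents (attach n G vs) (Suc n). shifted_deg m (attach n G vs) p) \<le>
      measure_pmf.expectation (choices m n G) (\<lambda>vs. \<Prod>p\<in>#mset vs. (real m + 1) * shifted_deg m G p)"
    proof (intro expectation_mono finite_choices[OF G m n])
      fix vs assume "vs \<in> set_pmf (choices m n G)"
      note vs = set_choices[OF G m n this]
      have "parents (attach n G vs) (Suc n) = mset vs"
        using parents_attach_new[OF vs(1)] G by (simp add: pa_graph_def)
      moreover have "shifted_deg m (attach n G vs) p \<le> (real m + 1) * shifted_deg m G p" if "p \<in> set vs" for p
      proof -
        have "count (mset vs) p \<le> m" using count_le_size[of "mset vs" p] vs(2) by simp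
        moreover have "real m * 1 \<le> real m * shifted_deg m G p"
          using shifted_deg_pos[OF m, of G p] by (intro mult_left_mono) auto
        ultimately show ?thesis
          using shifted_deg_attach[OF vs(1), of p m G] that vs(1) by (auto simp: algebra_simps subset_iff)
      qed
      ultimately show "(\<Prod>p\<in>#parents (attach n G vs) (Suc n). shifted_deg m (attach n G vs) p)
          \<le> (\<Prod>p\<in>#mset vs. (real m + 1) * shifted_deg m G p)"
        using order_trans[OF zero_le_one shifted_deg_pos[OF m]]
        by (simp del: prod_mset.distrib) (intro prod_mset_mono_real, auto)
    qed
    also have "\<dots> = measure_pmf.expectation (choice_pmf n G) (\<lambda>p. (real m + 1) * shifted_deg m G p) ^ m"
      unfolding choices_def by (rule expectation_replicate_prod[OF fin])
    also have "\<dots> \<le> ((real m + 1) / T * S G) ^ m"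
    proof (rule power_mono)
      have "measure_pmf.expectation (choice_pmf n G) (\<lambda>p. (real m + 1) * shifted_deg m G p) =
          (\<Sum>u\<in>{1..n}. pmf (choice_pmf n G) u * ((real m + 1) * shifted_deg m G u))"
        using set_choice_pmf[OF G m n] by (subst integral_measure_pmf[of "{1..n}"]) auto
      also have "\<dots> \<le> (\<Sum>u\<in>{1..n}. (shifted_deg m G u / T) * ((real m + 1) * shifted_deg m G u))"
      proof (intro sum_mono mult_right_mono)
        fix u assume "u \<in> {1..n}"
        then show "pmf (choice_pmf n G) u \<le> shifted_deg m G u / T"
          unfolding pmf_choice_pmf_graph[OF G m n] total_degree_real[OF n] T_def[symmetric]
          using T by (simp add: shifted_deg_def divide_right_mono)
      qed (use order_trans[OF zero_le_one shifted_deg_pos[OF m]] in auto)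
      also have "\<dots> = (real m + 1) / T * S G"
        unfolding S_def sum_distrib_left by (intro sum.cong refl) (simp add: power2_eq_square)
      finally show "measure_pmf.expectation (choice_pmf n G) (\<lambda>p. (real m + 1) * shifted_deg m G p)
          \<le> (real m + 1) / T * S G" .
    next
      show "0 \<le> measure_pmf.expectation (choice_pmf n G) (\<lambda>p. (real m + 1) * shifted_deg m G p)"
        using order_trans[OF zero_le_one shifted_deg_pos[OF m]] by (intro integral_nonneg_AE) auto
    qed
    finally show "measure_pmf.expectation (choices m n G)
        (\<lambda>vs. \<Prod>p\<in>#parents (attach n G vs) (Suc n). shifted_deg m (attach n G vs) p) \<le>
        ((real m + 1) / T * S G) ^ m" .
  qed
  also have "\<dots> = ((real m + 1) / T) ^ m * measure_pmf.expectation (PA m n) (\<lambda>G. S G ^ m)"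
    unfolding power_mult_distrib by simp
  also have "measure_pmf.expectation (PA m n) (\<lambda>G. S G ^ m) \<le>
      (\<Sum>u\<in>{1..n}. (3 * real m * (growth n / growth u))\<^sup>2) ^ m"
    using expectation_square_sum_product[OF m n, of "{#}" m] by (simp add: S_def)
  finally show ?thesis using T
    unfolding power_mult_distrib T_def[symmetric]
    by (simp add: mult_left_mono)
qed

text \<open>
  Once \<open>v\<close> is born, its parents are a fixed multiset of \<open>m\<close> vertices, to which the one-step estimate
  for products applies.
\<close>

lemma expectation_parents_growth:
  assumes m: "m \<ge> 1" and v: "2 \<le> v" and n: "v \<le> n"
  shows "measure_pmf.expectation (PA m n) (\<lambda>G. \<Prod>p\<in>#parents G v. shifted_deg m G p)
    \<le> (growth n / growth v) ^ m * measure_pmf.expectation (PA m v) (\<lambda>G. \<Prod>p\<in>#parents G v. shifted_deg m G p)"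
  using n
proof (induction n rule: nat_induct_at_least)
  case base
  then show ?case by simp
next
  case (Suc n)
  have n: "n \<ge> 1" using Suc.hyps v by simp
  have "measure_pmf.expectation (PA m (Suc n)) (\<lambda>G. \<Prod>p\<in>#parents G v. shifted_deg m G p) =
     measure_pmf.expectation (PA m n) (\<lambda>G. measure_pmf.expectation (choices m n G)
       (\<lambda>vs. \<Prod>p\<in>#parents (attach n G vs) v. shifted_deg m (attach n G vs) p))"
    by (rule expectation_PA_Suc[OF m n])
  also have "\<dots> \<le> measure_pmf.expectation (PA m n)
      (\<lambda>G. (\<Prod>p\<in>#parents G v. shifted_deg m G p) * (growth (Suc n) / growth n) ^ m)"
  proof (intro expectation_mono finite_PA m n)
    fix G assume "G \<in> set_pmf (PA m n)"
    then have G: "pa_graph m n G" by (rule pa_graph_PA[OF m n])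
    have size: "size (parents G v) = m"
      using G v Suc.hyps by (simp add: pa_graph_def)
    have "set_mset (parents G v) \<subseteq> {1..n}"
      using set_parents[of G v] Suc.hyps by auto
    then show "measure_pmf.expectation (choices m n G)
       (\<lambda>vs. \<Prod>p\<in>#parents (attach n G vs) v. shifted_deg m (attach n G vs) p) \<le>
       (\<Prod>p\<in>#parents G v. shifted_deg m G p) * (growth (Suc n) / growth n) ^ m"
      using expectation_attach_product[OF G m n, of "parents G v"] parents_attach[OF Suc.hyps] size
      by simp
  qed
  also have "\<dots> = (growth (Suc n) / growth n) ^ m *
      measure_pmf.expectation (PA m n) (\<lambda>G. \<Prod>p\<in>#parents G v. shifted_deg m G p)"
    by simp
  also have "\<dots> \<le> (growth (Suc n) / growth n) ^ m * ((growth n / growth v) ^ m *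
      measure_pmf.expectation (PA m v) (\<lambda>G. \<Prod>p\<in>#parents G v. shifted_deg m G p))"
    by (intro mult_left_mono Suc.IH) (simp add: less_imp_le)
  finally show ?case by (simp add: power_divide)
qed

section \<open>Vertices with the same parents\<close>

text \<open>
  There are at most \<open>k!\<close> orders in which independent draws can produce a given multiset.
\<close>

lemma prob_replicate_mset_le:
  assumes fin: "finite (set_pmf q)" and M: "size M = k"
  shows "measure_pmf.prob (replicate_pmf k q) {vs. mset vs = M} \<le> fact k * (\<Prod>p\<in>#M. pmf q p)"
  using M
proof (induction k arbitrary: M)
  case 0
  then show ?case by simp
next
  case (Suc k)
  have "measure_pmf.prob (replicate_pmf (Suc k) q) {vs. mset vs = M} =
      measure_pmf.expectation q (\<lambda>x. measure_pmf.prob (replicate_pmf k q) {vs. mset (x # vs) = M})"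
    unfolding prob_expectation by (rule expectation_replicate_Suc[OF fin])
  also have "\<dots> = (\<Sum>x\<in>set_mset M. pmf q x * measure_pmf.prob (replicate_pmf k q) {vs. mset (x # vs) = M})"
  proof (subst integral_measure_pmf[of "set_mset M"])
    fix x assume "measure_pmf.prob (replicate_pmf k q) {vs. mset (x # vs) = M} \<noteq> 0"
    then have "{vs. mset (x # vs) = M} \<noteq> {}" by force
    then show "x \<in># M" by auto
  qed auto
  also have "\<dots> \<le> (\<Sum>x\<in>set_mset M. fact k * (\<Prod>p\<in>#M. pmf q p))"
  proof (rule sum_mono)
    fix x assume x: "x \<in># M"
    have "{vs. mset (x # vs) = M} = {vs. mset vs = M - {#x#}}"
      using x by (auto dest: multi_member_split)
    then have "pmf q x * measure_pmf.prob (replicate_pmf k q) {vs. mset (x # vs) = M} \<le>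
        pmf q x * (fact k * (\<Prod>p\<in>#M - {#x#}. pmf q p))"
      using Suc.IH[of "M - {#x#}"] Suc.prems x by (simp add: mult_left_mono size_Diff_singleton)
    also have "\<dots> = fact k * (\<Prod>p\<in>#M. pmf q p)"
      using x by (auto dest!: multi_member_split)
    finally show "pmf q x * measure_pmf.prob (replicate_pmf k q) {vs. mset (x # vs) = M} \<le>
        fact k * (\<Prod>p\<in>#M. pmf q p)" .
  qed
  also have "\<dots> \<le> real (Suc k) * (fact k * (\<Prod>p\<in>#M. pmf q p))"
  proof -
    have "card (set_mset M) \<le> Suc k"
    proof -
      have "card (set_mset M) = (\<Sum>x\<in>set_mset M. 1)" by simp
      also have "\<dots> \<le> (\<Sum>x\<in>set_mset M. count M x)" by (intro sum_mono) (simp add: Suc_le_eq)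
      also have "\<dots> = Suc k" using size_eq_sum_count[of "set_mset M" M] Suc.prems by simp
      finally show ?thesis .
    qed
    then show ?thesis
      by (simp add: mult_right_mono prod_mset_nonneg_real del: of_nat_Suc)
  qed
  finally show ?case by simp
qed

lemma prob_same_parents_new:
  assumes m: "m \<ge> 1" and v: "2 \<le> v" "v \<le> n"
  shows "measure_pmf.prob (PA m (Suc n)) {G. parents G v = parents G (Suc n)} \<le>
    fact m / (real m * (2 * real n - 1)) ^ m *
      measure_pmf.expectation (PA m n) (\<lambda>G. \<Prod>p\<in>#parents G v. shifted_deg m G p)"
proof -
  have n: "n \<ge> 1" using v by simp
  define T where "T = real m * (2 * real n - 1)"
  have T: "T > 0" using m n by (simp add: T_def)
  have "measure_pmf.prob (PA m (Suc n)) {G. parents G v = parents G (Suc n)} =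
      measure_pmf.expectation (PA m n) (\<lambda>G. measure_pmf.prob (choices m n G)
        {vs. parents (attach n G vs) v = parents (attach n G vs) (Suc n)})"
    unfolding prob_expectation by (rule expectation_PA_Suc[OF m n])
  also have "\<dots> \<le> measure_pmf.expectation (PA m n)
      (\<lambda>G. fact m / T ^ m * (\<Prod>p\<in>#parents G v. shifted_deg m G p))"
  proof (intro expectation_mono finite_PA m n)
    fix G assume "G \<in> set_pmf (PA m n)"
    then have G: "pa_graph m n G" by (rule pa_graph_PA[OF m n])
    have size: "size (parents G v) = m"
      using G v by (simp add: pa_graph_def)
    have "measure_pmf.prob (choices m n G)
        {vs. parents (attach n G vs) v = parents (attach n G vs) (Suc n)} =
      measure_pmf.prob (choices m n G) {vs. mset vs = parents G v}"
      unfolding prob_expectation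
    proof (intro expectation_cong)
      fix vs assume "vs \<in> set_pmf (choices m n G)"
      then have "parents (attach n G vs) (Suc n) = mset vs"
        using parents_attach_new[OF set_choices(1)[OF G m n]] G by (simp add: pa_graph_def)
      then show "of_bool (parents (attach n G vs) v = parents (attach n G vs) (Suc n)) =
          (of_bool (mset vs = parents G v) :: real)"
        using parents_attach[OF v(2)] by (simp add: eq_commute)
    qed
    also have "\<dots> \<le> fact m * (\<Prod>p\<in>#parents G v. pmf (choice_pmf n G) p)"
      unfolding choices_def by (rule prob_replicate_mset_le[OF finite_choice_pmf[OF G m n] size])
    also have "\<dots> \<le> fact m * (\<Prod>p\<in>#parents G v. shifted_deg m G p / T)"
    proof (intro mult_left_mono prod_mset_mono_real conjI pmf_nonneg)
      fix p
      have "0 \<le> shifted_deg m G p" by (simp add: shifted_deg_def)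
      then show "pmf (choice_pmf n G) p \<le> shifted_deg m G p / T"
        unfolding pmf_choice_pmf_graph[OF G m n] total_degree_real[OF n] T_def[symmetric]
        using T by (simp add: shifted_deg_def divide_right_mono)
    qed simp
    also have "\<dots> = fact m / T ^ m * (\<Prod>p\<in>#parents G v. shifted_deg m G p)"
      by (simp only: prod_mset_divide_real prod_mset_const size) simp
    finally show "measure_pmf.prob (choices m n G)
        {vs. parents (attach n G vs) v = parents (attach n G vs) (Suc n)} \<le>
        fact m / T ^ m * (\<Prod>p\<in>#parents G v. shifted_deg m G p)" .
  qed
  finally show ?thesis by (simp add: T_def)
qed

text \<open>
  Parents are never changed by later vertices, so it suffices to look at the time when \<open>w\<close> is born.
\<close>

lemma prob_parents_stable:
  assumes m: "m \<ge> 1" and w: "1 \<le> w" "w \<le> n" and v: "v \<le> w"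
  shows "measure_pmf.prob (PA m n) {G. parents G v = parents G w} =
    measure_pmf.prob (PA m w) {G. parents G v = parents G w}"
  using w(2)
proof (induction n rule: nat_induct_at_least)
  case (Suc n)
  have "measure_pmf.prob (PA m (Suc n)) {G. parents G v = parents G w} =
      measure_pmf.expectation (PA m n) (\<lambda>G. measure_pmf.prob (choices m n G)
        {vs. parents (attach n G vs) v = parents (attach n G vs) w})"
    unfolding prob_expectation using Suc.hyps w by (intro expectation_PA_Suc m) simp
  also have "\<dots> = measure_pmf.expectation (PA m n) (\<lambda>G. of_bool (parents G v = parents G w))"
  proof (intro expectation_cong)
    fix G
    show "measure_pmf.prob (choices m n G)
        {vs. parents (attach n G vs) v = parents (attach n G vs) w} =
      of_bool (parents G v = parents G w)"
      using parents_attach[of v n G] parents_attach[of w n G] v Suc.hyps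
      by (cases "parents G v = parents G w") simp_all
  qed
  also have "\<dots> = measure_pmf.prob (PA m n) {G. parents G v = parents G w}"
    by (rule prob_expectation[symmetric])
  finally show ?case using Suc.IH by simp
qed simp

text \<open>
  The bounds \<open>n \<le> growth n ^ 2 \<le> C n\<close> follow from \<open>1 + x \<le> exp x \<le> 1 / (1 - x)\<close>, both of which
  telescope.
\<close>

lemma growth_sq_lower: "n \<ge> 1 \<Longrightarrow> real n \<le> (growth n)\<^sup>2"
proof (induction n rule: nat_induct_at_least)
  case base
  show ?case by (simp add: growth_def)
next
  case (Suc n)
  have "real (Suc n) \<le> real n * (1 + 2 / (2 * real n - 1))"
    using Suc.hyps by (simp add: field_simps)
  also have "\<dots> \<le> (growth n)\<^sup>2 * exp (2 / (2 * real n - 1))"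
    using Suc by (intro mult_mono exp_ge_add_one_self) auto
  also have "\<dots> = (growth (Suc n))\<^sup>2"
    using Suc.hyps by (simp add: growth_Suc power_mult_distrib exp_double[symmetric])
  finally show ?case .
qed

lemma growth_sq_upper:
  assumes "n \<ge> 1"
  shows "(growth n)\<^sup>2 \<le> 2 * exp 2 * real n"
proof (cases "n = 1")
  case True
  have "(1::real) \<le> 2 * exp 2" using exp_ge_add_one_self[of "2::real"] by linarith
  then show ?thesis using True by (simp add: growth_def)
next
  case False
  then have "n \<ge> 2" using assms by simp
  then have "(growth n)\<^sup>2 \<le> 2 * exp 2 * (real n - 3 / 2)"
  proof (induction n rule: nat_induct_at_least)
    case base
    have "growth 2 = exp 1" using growth_Suc[of 1] by (simp add: growth_def numeral_2_eq_2)
    then show ?case by (simp add: exp_double[symmetric])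
  next
    case (Suc n)
    define y where "y = 2 / (2 * real n - 1)"
    have y: "0 < y" "y < 1" using Suc.hyps by (simp_all add: y_def field_simps)
    have "1 - y \<le> exp (- y)" using exp_ge_add_one_self[of "- y"] by simp
    then have "exp y * (1 - y) \<le> exp y * exp (- y)"
      by (intro mult_left_mono) auto
    then have "exp y \<le> 1 / (1 - y)"
      using y by (simp add: exp_add[symmetric] field_simps)
    moreover have "(growth (Suc n))\<^sup>2 = (growth n)\<^sup>2 * exp y"
      using Suc.hyps by (simp add: growth_Suc power_mult_distrib exp_double[symmetric] y_def)
    ultimately have "(growth (Suc n))\<^sup>2 \<le> (2 * exp 2 * (real n - 3 / 2)) * (1 / (1 - y))"
      using Suc y by (simp only:) (intro mult_mono, auto)
    also have "\<dots> = 2 * exp 2 * (real (Suc n) - 3 / 2)"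
      using Suc.hyps by (simp add: y_def field_simps)
    finally show ?case .
  qed
  also have "\<dots> \<le> 2 * exp 2 * real n" by simp
  finally show ?thesis .
qed

lemma growth_quotient_sq:
  assumes "v \<ge> 1" "n \<ge> 1"
  shows "(growth n / growth v)\<^sup>2 \<le> 2 * exp 2 * (real n / real v)"
proof -
  have "(growth n)\<^sup>2 / (growth v)\<^sup>2 \<le> (2 * exp 2 * real n) / real v"
    using growth_sq_upper[OF assms(2)] growth_sq_lower[OF assms(1)] assms by (intro frac_le) auto
  then show ?thesis by (simp add: power_divide)
qed

text \<open>
  Harmonic numbers grow more slowly than any power, because \<open>1 / u\<close> is at most \<open>n\<close> to the power
  \<open>\<epsilon>\<close> times \<open>u\<close> to the power \<open>- 1 - \<epsilon>\<close>, the term of a convergent series.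
\<close>

lemma sum_inverse_le_powr:
  fixes \<epsilon> :: real
  assumes "\<epsilon> > 0"
  obtains Z where "Z > 0" "\<And>n. (\<Sum>u\<in>{1..n}. 1 / real u) \<le> Z * real n powr \<epsilon>"
proof -
  define Z where "Z = (\<Sum>u. real u powr (- 1 - \<epsilon>))"
  have summable: "summable (\<lambda>u. real u powr (- 1 - \<epsilon>))"
    using assms by (simp add: summable_real_powr_iff)
  have "(\<Sum>u\<in>{1..n}. 1 / real u) \<le> (Z + 1) * real n powr \<epsilon>" for n
  proof -
    have "(\<Sum>u\<in>{1..n}. 1 / real u) = (\<Sum>u\<in>{1..n}. real u powr (- 1 - \<epsilon>) * real u powr \<epsilon>)"
      by (intro sum.cong refl) (simp add: powr_add[symmetric] powr_minus_divide)
    also have "\<dots> \<le> (\<Sum>u\<in>{1..n}. real u powr (- 1 - \<epsilon>) * real n powr \<epsilon>)"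
      using assms by (intro sum_mono mult_left_mono powr_mono2) auto
    also have "\<dots> = (\<Sum>u\<in>{1..n}. real u powr (- 1 - \<epsilon>)) * real n powr \<epsilon>"
      by (simp add: sum_distrib_right)
    also have "\<dots> \<le> Z * real n powr \<epsilon>"
      unfolding Z_def by (intro mult_right_mono sum_le_suminf summable) auto
    also have "\<dots> \<le> (Z + 1) * real n powr \<epsilon>"
      by (intro mult_right_mono) auto
    finally show ?thesis .
  qed
  moreover have "Z \<ge> 0"
    unfolding Z_def by (intro suminf_nonneg summable) auto
  ultimately show ?thesis by (intro that[of "Z + 1"]) auto
qed

lemma power_eq_sq_powr:
  assumes "(x::real) > 0"
  shows "x ^ m = (x\<^sup>2) powr (real m / 2)"
proof -
  have "x\<^sup>2 = x powr 2" using assms by simp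
  then have "(x\<^sup>2) powr (real m / 2) = x powr (real m)"
    by (simp only: powr_powr) simp
  then show ?thesis using assms by (simp add: powr_realpow)
qed

text \<open>
  The estimates above give the order \<open>(v w)\<close> to the power \<open>- m / 2\<close>, up to the \<open>m\<close>-th power of a
  harmonic number, which is bounded by \<open>v\<close> to the power \<open>1 / 4\<close>.  For \<open>m \<ge> 3\<close> the sum over all pairs
  converges.
\<close>

lemma prob_same_parents:
  assumes m: "m \<ge> 3"
  obtains C where "C > 0" "\<And>v w n. 2 \<le> v \<Longrightarrow> v < w \<Longrightarrow> w \<le> n \<Longrightarrow>
    measure_pmf.prob (PA m n) {G. parents G v = parents G w} \<le>
      C * (real v powr (- 5 / 4) * real w powr (- 3 / 2))"
proof -
  have m1: "m \<ge> 1" using m by simp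
  \<comment> \<open>The \<open>m\<close>-th power of the harmonic number may cost \<open>v\<close> to the power \<open>1 / 4\<close> in total.\<close>
  define \<epsilon> where "\<epsilon> = 1 / (4 * real m)"
  have "\<epsilon> > 0" using m by (simp add: \<epsilon>_def)
  then obtain Z where Z: "Z > 0" "\<And>n. (\<Sum>u\<in>{1..n}. 1 / real u) \<le> Z * real n powr \<epsilon>"
    using sum_inverse_le_powr by blast
  define A where "A = (real m + 1) * 9 * real m * (2 * exp 2) * Z"
  define B where "B = (2 * exp (2::real)) powr (real m / 2)"
  have A: "A > 0" using Z m by (simp add: A_def)
  define C where "C = fact m * B * A ^ m"
  have "C > 0" using A by (simp add: C_def B_def)
  moreover have "measure_pmf.prob (PA m n) {G. parents G v = parents G w} \<le>
      C * (real v powr (- 5 / 4) * real w powr (- 3 / 2))"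
    if v: "2 \<le> v" and vw: "v < w" and w: "w \<le> n" for v w n
  proof -
    obtain k where k: "w = Suc k" "v \<le> k" "k \<ge> 2" using vw v by (cases w) auto
    obtain j where j: "v = Suc j" "j \<ge> 1" using v by (cases v) auto
    define F where "F = (\<lambda>n. measure_pmf.expectation (PA m n) (\<lambda>G. \<Prod>p\<in>#parents G v. shifted_deg m G p))"
    have "F v \<le> ((real m + 1) / (real m * (2 * real j - 1)) *
        (\<Sum>u\<in>{1..j}. (3 * real m * (growth j / growth u))\<^sup>2)) ^ m"
      unfolding F_def j(1) by (rule expectation_new_parents[OF m1 j(2)])
    also have "\<dots> \<le> (A * real v powr \<epsilon>) ^ m"
    proof (rule power_mono)
      have "(\<Sum>u\<in>{1..j}. (3 * real m * (growth j / growth u))\<^sup>2) \<le>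
          (\<Sum>u\<in>{1..j}. 9 * (real m)\<^sup>2 * (2 * exp 2 * (real j / real u)))"
        unfolding power_mult_distrib using j(2)
        by (intro sum_mono mult_mono growth_quotient_sq) auto
      also have "\<dots> = 9 * (real m)\<^sup>2 * (2 * exp 2) * real j * (\<Sum>u\<in>{1..j}. 1 / real u)"
        unfolding sum_distrib_left by (intro sum.cong refl) simp
      also have "\<dots> \<le> 9 * (real m)\<^sup>2 * (2 * exp 2) * real j * (Z * real v powr \<epsilon>)"
      proof (intro mult_left_mono)
        have "Z * real j powr \<epsilon> \<le> Z * real v powr \<epsilon>"
          using Z(1) j \<open>\<epsilon> > 0\<close> by (intro mult_left_mono powr_mono2) auto
        then show "(\<Sum>u\<in>{1..j}. 1 / real u) \<le> Z * real v powr \<epsilon>"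
          using Z(2)[of j] by linarith
      qed auto
      finally have S: "(\<Sum>u\<in>{1..j}. (3 * real m * (growth j / growth u))\<^sup>2) \<le>
          9 * (real m)\<^sup>2 * (2 * exp 2) * real j * (Z * real v powr \<epsilon>)" .
      have "(real m + 1) / (real m * (2 * real j - 1)) \<le> (real m + 1) / (real m * real j)"
        using m j(2) by (intro divide_left_mono mult_left_mono) auto
      then have "(real m + 1) / (real m * (2 * real j - 1)) *
          (\<Sum>u\<in>{1..j}. (3 * real m * (growth j / growth u))\<^sup>2) \<le>
        (real m + 1) / (real m * real j) *
          (9 * (real m)\<^sup>2 * (2 * exp 2) * real j * (Z * real v powr \<epsilon>))"
        using S by (intro mult_mono) (auto intro!: sum_nonneg)
      also have "\<dots> = A * real v powr \<epsilon>"
        using m j(2) by (simp add: A_def field_simps power2_eq_square)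
      finally show "(real m + 1) / (real m * (2 * real j - 1)) *
          (\<Sum>u\<in>{1..j}. (3 * real m * (growth j / growth u))\<^sup>2) \<le> A * real v powr \<epsilon>" .
    next
      show "0 \<le> (real m + 1) / (real m * (2 * real j - 1)) *
          (\<Sum>u\<in>{1..j}. (3 * real m * (growth j / growth u))\<^sup>2)"
        using j(2) by (intro mult_nonneg_nonneg sum_nonneg) auto
    qed
    also have "\<dots> = A ^ m * real v powr (1 / 4)"
      using v m by (simp add: power_mult_distrib powr_power \<epsilon>_def)
    finally have Fv: "F v \<le> A ^ m * real v powr (1 / 4)" .
    have quot: "(growth k / growth v) ^ m \<le> B * (real w / real v) powr (real m / 2)"
    proof -
      have "(growth k / growth v) ^ m = ((growth k / growth v)\<^sup>2) powr (real m / 2)"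
        by (intro power_eq_sq_powr) simp
      also have "\<dots> \<le> (2 * exp 2 * (real w / real v)) powr (real m / 2)"
      proof (intro powr_mono2)
        have "(growth k / growth v)\<^sup>2 \<le> 2 * exp 2 * (real k / real v)"
          using k v by (intro growth_quotient_sq) auto
        also have "\<dots> \<le> 2 * exp 2 * (real w / real v)"
          using k by (intro mult_left_mono divide_right_mono) auto
        finally show "(growth k / growth v)\<^sup>2 \<le> 2 * exp 2 * (real w / real v)" .
      qed auto
      also have "\<dots> = B * (real w / real v) powr (real m / 2)"
        unfolding B_def by (intro powr_mult)
      finally show ?thesis .
    qed
    have "F k \<le> (growth k / growth v) ^ m * F v"
      unfolding F_def by (rule expectation_parents_growth[OF m1 v k(2)])
    also have "\<dots> \<le> (B * (real w / real v) powr (real m / 2)) * (A ^ m * real v powr (1 / 4))"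
      using quot Fv by (intro mult_mono) (auto simp: B_def F_def shifted_deg_def intro!: mult_nonneg_nonneg
          integral_nonneg_AE prod_mset_nonneg_real)
    finally have Fk: "F k \<le> (B * (real w / real v) powr (real m / 2)) * (A ^ m * real v powr (1 / 4))" .
    have "measure_pmf.prob (PA m n) {G. parents G v = parents G w} =
        measure_pmf.prob (PA m (Suc k)) {G. parents G v = parents G (Suc k)}"
      using prob_parents_stable[OF m1, of w n v] k w v vw by simp
    also have "\<dots> \<le> fact m / (real m * (2 * real k - 1)) ^ m * F k"
      unfolding F_def by (rule prob_same_parents_new[OF m1 v k(2)])
    also have "\<dots> \<le> fact m / real w ^ m *
        ((B * (real w / real v) powr (real m / 2)) * (A ^ m * real v powr (1 / 4)))"
    proof (rule mult_mono)
      have "real w \<le> 3 * (2 * real k - 1)" using k by simp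
      also have "\<dots> \<le> real m * (2 * real k - 1)"
        using k m by (intro mult_right_mono) auto
      finally show "fact m / (real m * (2 * real k - 1)) ^ m \<le> fact m / real w ^ m"
        using k m by (intro divide_left_mono power_mono mult_pos_pos zero_less_power) auto
    qed (use Fk A in \<open>auto simp: F_def shifted_deg_def intro!: integral_nonneg_AE prod_mset_nonneg_real\<close>)
    also have "\<dots> = C * (real v powr (1 / 4) * (real w * real v) powr (- real m / 2))"
      using v vw by (simp add: C_def powr_divide powr_mult powr_minus_divide
          powr_realpow[symmetric] powr_half_sqrt field_simps powr_add[symmetric])
    also have "\<dots> \<le> C * (real v powr (1 / 4) * (real w * real v) powr (- 3 / 2))"
      using v vw m \<open>C > 0\<close> mult_mono[of 1 "real w" 1 "real v"]
      by (intro mult_left_mono powr_mono) auto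
    also have "\<dots> = C * (real v powr (- 5 / 4) * real w powr (- 3 / 2))"
      using v vw by (simp add: powr_mult powr_add[symmetric] mult_ac)
    finally show ?thesis .
  qed
  ultimately show ?thesis by (rule that)
qed

section \<open>An Abel-type identity\<close>

text \<open>
  Divided by \<open>T ^ n\<close>, this is the sum over \<open>k\<close> of the probabilities that a vertex of degree \<open>x - k\<close>
  receives exactly \<open>k\<close> of \<open>n\<close> edges when the total degree is \<open>T\<close>: the total weight with which the
  states at one time contribute to the state \<open>x\<close> at the next.
\<close>

definition abel_sum :: "nat \<Rightarrow> real \<Rightarrow> real \<Rightarrow> real" where
  "abel_sum n x T = (\<Sum>k\<le>n. real (n choose k) * ((x - real k) ^ k * (T - x + real k) ^ (n - k)))"

text \<open>
  The auxiliary sum with one more factor \<open>x - k\<close>, by which consecutive \<open>abel_sum\<close> are related.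
\<close>

definition abel_moment :: "nat \<Rightarrow> real \<Rightarrow> real \<Rightarrow> real" where
  "abel_moment n x T = (\<Sum>k\<le>n. real (n choose k) * ((x - real k) ^ Suc k * (T - x + real k) ^ (n - k)))"

fun abel_poly :: "nat \<Rightarrow> real \<Rightarrow> real" where
  "abel_poly 0 T = 1"
| "abel_poly (Suc n) T = T ^ Suc n - real (Suc n) * abel_poly n T"

lemma sum_binomial_Suc:
  fixes f :: "nat \<Rightarrow> real"
  shows "(\<Sum>k\<le>Suc n. real (Suc n choose k) * f k) = (\<Sum>k\<le>n. real (n choose k) * (f k + f (Suc k)))"
proof -
  have "(\<Sum>k\<le>Suc n. real (Suc n choose k) * f k) =
      f 0 + (\<Sum>k\<le>n. real (Suc n choose Suc k) * f (Suc k))"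
    by (simp only: sum.atMost_Suc_shift) simp
  also have "\<dots> = (\<Sum>k\<le>n. real (n choose k) * f (Suc k)) +
      (f 0 + (\<Sum>k\<le>n. real (n choose Suc k) * f (Suc k)))"
    by (simp add: sum.distrib algebra_simps)
  also have "f 0 + (\<Sum>k\<le>n. real (n choose Suc k) * f (Suc k)) = (\<Sum>k\<le>Suc n. real (n choose k) * f k)"
    by (simp only: sum.atMost_Suc_shift) simp
  also have "\<dots> = (\<Sum>k\<le>n. real (n choose k) * f k)"
    by simp
  finally show ?thesis by (simp add: sum.distrib algebra_simps)
qed

text \<open>
  Pascal's rule, with one factor \<open>T - x + k = T - (x - k)\<close> split off in the first part.
\<close>

lemma abel_sum_Suc:
  "abel_sum (Suc n) x T = T * abel_sum n x T - abel_moment n x T + abel_moment n (x - 1) T"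
proof -
  have ring: "c * (z ^ k * (u * q) + r) = T * (c * (z ^ k * q)) - c * (z ^ Suc k * q) + c * r"
    if "u = T - z" for c q r u z :: real and k
    unfolding that by (simp add: algebra_simps)
  have "abel_sum (Suc n) x T = (\<Sum>k\<le>n. real (n choose k) *
      ((x - real k) ^ k * (T - x + real k) ^ (Suc n - k) +
       (x - real (Suc k)) ^ Suc k * (T - x + real (Suc k)) ^ (Suc n - Suc k)))"
    unfolding abel_sum_def by (rule sum_binomial_Suc)
  also have "\<dots> = (\<Sum>k\<le>n.
      T * (real (n choose k) * ((x - real k) ^ k * (T - x + real k) ^ (n - k))) -
      real (n choose k) * ((x - real k) ^ Suc k * (T - x + real k) ^ (n - k)) +
      real (n choose k) * ((x - 1 - real k) ^ Suc k * (T - (x - 1) + real k) ^ (n - k)))"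
  proof (intro sum.cong refl)
    fix k assume "k \<in> {..n}"
    then have "Suc n - k = Suc (n - k)" by auto
    moreover have "x - real (Suc k) = x - 1 - real k" "T - x + real (Suc k) = T - (x - 1) + real k"
      by auto
    ultimately show "real (n choose k) *
      ((x - real k) ^ k * (T - x + real k) ^ (Suc n - k) +
       (x - real (Suc k)) ^ Suc k * (T - x + real (Suc k)) ^ (Suc n - Suc k)) =
      T * (real (n choose k) * ((x - real k) ^ k * (T - x + real k) ^ (n - k))) -
      real (n choose k) * ((x - real k) ^ Suc k * (T - x + real k) ^ (n - k)) +
      real (n choose k) * ((x - 1 - real k) ^ Suc k * (T - (x - 1) + real k) ^ (n - k))"
      by (simp only: diff_Suc_Suc power_Suc[of "T - x + real k"]) (rule ring, simp)
  qed
  finally show ?thesis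
    by (simp only: sum.distrib sum_subtractf sum_distrib_left[symmetric] abel_sum_def abel_moment_def)
qed

text \<open>
  One factor \<open>x - k\<close> is split into \<open>x\<close> and \<open>k\<close>, and \<open>k\<close> is absorbed into the binomial coefficient.
\<close>

lemma abel_moment_Suc:
  "abel_moment (Suc n) x T = x * abel_sum (Suc n) x T - real (Suc n) * abel_moment n (x - 1) T"
proof -
  define f where "f = (\<lambda>k. (x - real k) ^ k * (T - x + real k) ^ (Suc n - k))"
  have "abel_moment (Suc n) x T =
      (\<Sum>k\<le>Suc n. x * (real (Suc n choose k) * f k) - real (k * (Suc n choose k)) * f k)"
    unfolding abel_moment_def f_def by (intro sum.cong refl) (simp add: algebra_simps)
  also have "\<dots> = x * abel_sum (Suc n) x T - (\<Sum>k\<le>Suc n. real (k * (Suc n choose k)) * f k)"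
    by (simp only: sum_subtractf sum_distrib_left[symmetric] abel_sum_def f_def)
  also have "(\<Sum>k\<le>Suc n. real (k * (Suc n choose k)) * f k) =
      (\<Sum>k\<le>n. real (Suc k * (Suc n choose Suc k)) * f (Suc k))"
    by (subst sum.atMost_Suc_shift) (simp del: binomial_Suc_Suc)
  also have "\<dots> = (\<Sum>k\<le>n. real (Suc n) * (real (n choose k) *
      ((x - 1 - real k) ^ Suc k * (T - (x - 1) + real k) ^ (n - k))))"
  proof (intro sum.cong refl)
    fix k
    have "x - real (Suc k) = x - 1 - real k" "T - x + real (Suc k) = T - (x - 1) + real k"
      by auto
    then show "real (Suc k * (Suc n choose Suc k)) * f (Suc k) = real (Suc n) * (real (n choose k) *
      ((x - 1 - real k) ^ Suc k * (T - (x - 1) + real k) ^ (n - k)))"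
      by (simp only: Suc_times_binomial f_def diff_Suc_Suc of_nat_mult mult.assoc)
  qed
  finally show ?thesis by (simp only: abel_moment_def sum_distrib_left[symmetric])
qed

text \<open>
  The sum does not depend on \<open>x\<close>.  By \<open>abel_sum_Suc\<close> this amounts to saying that the increments of
  \<open>abel_moment\<close> in \<open>x\<close> are constant, so both facts are proved together.
\<close>

lemma abel_sum_eq: "abel_sum n x T = abel_poly n T"
  and abel_moment_diff: "abel_moment n x T - abel_moment n (x - 1) T =
    T * abel_poly n T - T ^ Suc n + real (Suc n) * abel_poly n T"
proof (induction n arbitrary: x)
  case 0
  {
    case 1
    show ?case by (simp add: abel_sum_def)
  next
    case 2
    show ?case by (simp add: abel_moment_def)
  }
next
  case (Suc n)
  have eq: "abel_sum (Suc n) x T = abel_poly (Suc n) T" for x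
    using abel_sum_Suc[of n x T] Suc(1)[of x] Suc(2)[of x] by simp
  {
    case 1
    show ?case by (rule eq)
  next
    case 2
    have "abel_moment (Suc n) x T - abel_moment (Suc n) (x - 1) T =
        abel_poly (Suc n) T - real (Suc n) * (abel_moment n (x - 1) T - abel_moment n (x - 1 - 1) T)"
      by (simp only: abel_moment_Suc eq) (simp add: algebra_simps)
    also have "\<dots> = abel_poly (Suc n) T -
        real (Suc n) * (T * abel_poly n T - T ^ Suc n + real (Suc n) * abel_poly n T)"
      by (simp only: Suc(2))
    also have "\<dots> = T * abel_poly (Suc n) T - T ^ Suc (Suc n) +
        real (Suc (Suc n)) * abel_poly (Suc n) T"
      by (simp add: algebra_simps)
    finally show ?case .
  }
qed

lemma abel_poly_bounds:
  assumes "real n \<le> T"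
  shows "0 \<le> abel_poly n T" "abel_poly n T \<le> T ^ n"
proof -
  have "0 \<le> abel_poly n T \<and> abel_poly n T \<le> T ^ n"
    using assms
  proof (induction n)
    case (Suc n)
    then have IH: "0 \<le> abel_poly n T" "abel_poly n T \<le> T ^ n" by auto
    have "real (Suc n) * abel_poly n T \<le> T * T ^ n"
      using Suc.prems IH by (intro mult_mono) auto
    then show ?case using IH by simp
  qed simp
  then show "0 \<le> abel_poly n T" "abel_poly n T \<le> T ^ n" by auto
qed

text \<open>
  The polynomial is the alternating sum of \<open>n! / (n - l)! * T ^ (n - l)\<close>; the bound stops after the
  term \<open>l = 2\<close>.
\<close>

lemma abel_poly_upper:
  assumes "real n \<le> T"
  shows "abel_poly n T \<le> T ^ n - real n * T ^ (n - 1) + real (n * (n - 1)) * T ^ (n - 2)"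
proof (cases n)
  case (Suc k)
  show ?thesis
  proof (cases k)
    case (Suc l)
    have "real (Suc (Suc l) * Suc l) * abel_poly l T \<le> real (Suc (Suc l) * Suc l) * T ^ l"
      using assms \<open>n = Suc k\<close> Suc by (intro mult_left_mono abel_poly_bounds(2)) auto
    then show ?thesis using \<open>n = Suc k\<close> Suc by (simp add: algebra_simps)
  qed (use Suc in simp)
qed simp

text \<open>
  The analogue of \<open>abel_sum\<close> for a pair of vertices.  The sum over the first vertex has been carried
  out and left \<open>abel_poly (m - j)\<close>; each term of the truncated polynomial turns the sum over the
  second vertex into an \<open>abel_sum\<close> again.  The leading correction \<open>- 2 * m / T\<close>
  is twice that for a single vertex.
\<close>

lemma abel_double_sum_le:
  assumes T: "real m \<le> T - y" and m: "m \<ge> 2" and y: "y \<ge> real m"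
  shows "(\<Sum>j\<le>m. real (m choose j) * (y - real j) ^ j * abel_poly (m - j) (T - y + real j)) \<le>
    T ^ m - 2 * real m * T ^ (m - 1) + 3 * real (m * (m - 1)) * T ^ (m - 2)"
proof -
  obtain k where k: "m = Suc (Suc k)" using m by (metis Suc_le_D numeral_2_eq_2 Suc_le_mono)
  let ?S = "\<lambda>j. T - y + real j"
  have ring: "c * p * (a - d * b + d * e * g) = c * (p * a) - d * c * (p * b) + e * (d * c) * (p * g)"
    for a b c d e g p :: real
    by (simp add: algebra_simps)
  have "(\<Sum>j\<le>m. real (m choose j) * (y - real j) ^ j * abel_poly (m - j) (?S j)) \<le>
      (\<Sum>j\<le>m. real (m choose j) * (y - real j) ^ j *
        (?S j ^ (m - j) - real (m - j) * ?S j ^ (m - j - 1) +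
         real ((m - j) * (m - j - 1)) * ?S j ^ (m - j - 2)))"
    using T y by (intro sum_mono mult_left_mono abel_poly_upper mult_nonneg_nonneg) auto
  also have "\<dots> = abel_sum m y T
      - (\<Sum>j\<le>m. real ((m - j) * (m choose j)) * ((y - real j) ^ j * ?S j ^ (m - j - 1)))
      + (\<Sum>j\<le>m. real ((m - j - 1) * ((m - j) * (m choose j))) * ((y - real j) ^ j * ?S j ^ (m - j - 2)))"
    unfolding abel_sum_def sum_subtractf[symmetric] sum.distrib[symmetric] of_nat_mult
    by (intro sum.cong refl ring)
  also have "(\<Sum>j\<le>m. real ((m - j) * (m choose j)) * ((y - real j) ^ j * ?S j ^ (m - j - 1))) =
      real m * abel_sum (m - 1) y T"
  proof -
    have "(\<Sum>j\<le>m. real ((m - j) * (m choose j)) * ((y - real j) ^ j * ?S j ^ (m - j - 1))) =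
        (\<Sum>j\<le>m - 1. real ((m - j) * (m choose j)) * ((y - real j) ^ j * ?S j ^ (m - j - 1)))"
      by (simp add: k)
    also have "\<dots> = (\<Sum>j\<le>m - 1. real m * (real (m - 1 choose j) * ((y - real j) ^ j * ?S j ^ (m - 1 - j))))"
      unfolding binomial_absorb_comp by (intro sum.cong refl) (simp add: diff_commute)
    finally show ?thesis by (simp only: abel_sum_def sum_distrib_left)
  qed
  also have "(\<Sum>j\<le>m. real ((m - j - 1) * ((m - j) * (m choose j))) * ((y - real j) ^ j * ?S j ^ (m - j - 2))) =
      real (m * (m - 1)) * abel_sum (m - 2) y T"
  proof -
    have *: "(m - j - 1) * ((m - j) * (m choose j)) = m * ((m - 1) * (m - 2 choose j))" for j
    proof -
      have "(m - j - 1) * ((m - j) * (m choose j)) = m * ((m - 1 - j) * (m - 1 choose j))"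
        by (simp add: binomial_absorb_comp)
      also have "\<dots> = m * ((m - 1) * (m - 2 choose j))"
        by (simp only: binomial_absorb_comp) (simp add: numeral_2_eq_2)
      finally show ?thesis .
    qed
    have "(\<Sum>j\<le>m. real ((m - j - 1) * ((m - j) * (m choose j))) * ((y - real j) ^ j * ?S j ^ (m - j - 2))) =
        (\<Sum>j\<le>m - 2. real ((m - j - 1) * ((m - j) * (m choose j))) * ((y - real j) ^ j * ?S j ^ (m - j - 2)))"
      by (simp add: k)
    also have "\<dots> = (\<Sum>j\<le>m - 2. real (m * (m - 1)) *
        (real (m - 2 choose j) * ((y - real j) ^ j * ?S j ^ (m - 2 - j))))"
      unfolding * by (intro sum.cong refl) (simp add: diff_commute)
    finally show ?thesis by (simp add: abel_sum_def sum_distrib_left)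
  qed
  also have "abel_sum m y T - real m * abel_sum (m - 1) y T + real (m * (m - 1)) * abel_sum (m - 2) y T =
      T ^ m - 2 * real m * T ^ (m - 1) + 3 * real (m * (m - 1)) * abel_poly (m - 2) T"
    by (simp add: abel_sum_eq k algebra_simps)
  also have "\<dots> \<le> T ^ m - 2 * real m * T ^ (m - 1) + 3 * real (m * (m - 1)) * T ^ (m - 2)"
    using T y by (intro add_left_mono mult_left_mono abel_poly_bounds(2)) auto
  finally show ?thesis .
qed

section \<open>Anti-concentration of degrees\<close>

text \<open>
  Pascal's rule for trinomial coefficients, according to what the first draw is.
\<close>

lemma trinomial_Suc:
  "(Suc k choose j) * (Suc k - j choose i) =
    (if i = 0 then 0 else (k choose j) * (k - j choose (i - 1))) +
    (if j = 0 then 0 else (k choose (j - 1)) * (k - (j - 1) choose i)) +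
    (k choose j) * (k - j choose i)"
proof (cases "j \<le> k")
  case True
  then have "Suc k - j = Suc (k - j)" by simp
  then show ?thesis using True by (cases i; cases j) (auto simp: algebra_simps Suc_diff_le)
next
  case False
  then show ?thesis by (cases j) (auto simp: binomial_eq_0 not_le)
qed

lemma prob_counts_replicate:
  fixes q :: "nat pmf"
  assumes fin: "finite (set_pmf q)" and vw: "v \<noteq> w"
  shows "measure_pmf.prob (replicate_pmf k q) {vs. count (mset vs) v = i \<and> count (mset vs) w = j} =
    real ((k choose j) * (k - j choose i)) *
      (pmf q v ^ i * pmf q w ^ j * (1 - pmf q v - pmf q w) ^ (k - j - i))"
proof (induction k arbitrary: i j)
  case 0
  show ?case by (cases i; cases j) (auto simp: indicator_def)
next
  case (Suc k)
  define a where "a = pmf q v"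
  define b where "b = pmf q w"
  define P where "P = (\<lambda>i j. measure_pmf.prob (replicate_pmf k q)
    {vs. count (mset vs) v = i \<and> count (mset vs) w = j})"
  define g where "g = (\<lambda>x. measure_pmf.prob (replicate_pmf k q)
    {vs. count (mset (x # vs)) v = i \<and> count (mset (x # vs)) w = j})"
  define A where "A = (if i = 0 then 0 else P (i - 1) j)"
  define B where "B = (if j = 0 then 0 else P i (j - 1))"
  have g: "g x = P i j + of_bool (x = v) * (A - P i j) + of_bool (x = w) * (B - P i j)" for x
  proof -
    have "{vs. Suc (count (mset vs) v) = i \<and> count (mset vs) w = j} =
        (if i = 0 then {} else {vs. count (mset vs) v = i - 1 \<and> count (mset vs) w = j})"
      by auto
    moreover have "{vs. count (mset vs) v = i \<and> Suc (count (mset vs) w) = j} =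
        (if j = 0 then {} else {vs. count (mset vs) v = i \<and> count (mset vs) w = j - 1})"
      by auto
    ultimately show ?thesis using vw by (auto simp: g_def P_def A_def B_def)
  qed
  have single: "measure_pmf.expectation q (\<lambda>x. of_bool (x = y)) = pmf q y" for y
  proof -
    have "{x. x = y} = {y}" by auto
    then show ?thesis
      using prob_expectation[of q "\<lambda>x. x = y"] by (simp add: measure_pmf_single)
  qed
  have "measure_pmf.prob (replicate_pmf (Suc k) q)
      {vs. count (mset vs) v = i \<and> count (mset vs) w = j} = measure_pmf.expectation q g"
    unfolding prob_expectation g_def by (rule expectation_replicate_Suc[OF fin])
  also have "\<dots> = P i j + a * (A - P i j) + b * (B - P i j)"
    unfolding g by (simp add: integrable_measure_pmf_finite[OF fin] single a_def b_def)
  also have "\<dots> = a * A + b * B + (1 - a - b) * P i j"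
    by (simp add: algebra_simps)
  also have "\<dots> = real ((Suc k choose j) * (Suc k - j choose i)) *
      (a ^ i * b ^ j * (1 - a - b) ^ (Suc k - j - i))"
  proof -
    define X where "X = a ^ i * b ^ j * (1 - a - b) ^ (Suc k - j - i)"
    have "a * A = real (if i = 0 then 0 else (k choose j) * (k - j choose (i - 1))) * X"
    proof (cases i)
      case (Suc i')
      show ?thesis
      proof (cases "j \<le> k")
        case True
        then show ?thesis
          using Suc by (simp add: A_def P_def Suc.IH a_def[symmetric] b_def[symmetric] X_def Suc_diff_le)
      qed (use Suc in \<open>simp add: A_def P_def Suc.IH\<close>)
    qed (simp add: A_def)
    moreover have "b * B = real (if j = 0 then 0 else (k choose (j - 1)) * (k - (j - 1) choose i)) * X"
      by (cases j) (simp_all add: B_def P_def Suc.IH a_def[symmetric] b_def[symmetric] X_def)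
    moreover have "(1 - a - b) * P i j = real ((k choose j) * (k - j choose i)) * X"
    proof (cases "j + i \<le> k")
      case True
      then have "Suc k - j - i = Suc (k - j - i)" by simp
      then show ?thesis
        by (simp add: P_def Suc.IH a_def[symmetric] b_def[symmetric] X_def)
    next
      case False
      then have "(k choose j) * (k - j choose i) = 0" by (auto simp: binomial_eq_0_iff)
      then show ?thesis by (simp only: P_def Suc.IH)
    qed
    ultimately show ?thesis
      unfolding trinomial_Suc of_nat_add X_def[symmetric] distrib_right by linarith
  qed
  finally show ?case by (simp only: a_def b_def)
qed

lemma prob_shifted_counts:
  fixes f :: "nat list \<Rightarrow> nat"
  assumes fin: "finite (set_pmf p)" and le: "\<And>vs. vs \<in> set_pmf p \<Longrightarrow> f vs \<le> m \<and> g vs \<le> m"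
  shows "measure_pmf.prob p {vs. d + f vs = x \<and> e + g vs = y} =
    (\<Sum>j\<le>m. \<Sum>i\<le>m. of_bool (d + i = x \<and> e + j = y) *
      measure_pmf.prob p {vs. f vs = i \<and> g vs = j})"
proof -
  have "measure_pmf.prob p {vs. d + f vs = x \<and> e + g vs = y} =
     measure_pmf.expectation p (\<lambda>vs. \<Sum>j\<le>m. \<Sum>i\<le>m.
       of_bool (d + i = x \<and> e + j = y) * of_bool (f vs = i \<and> g vs = j))"
    unfolding prob_expectation
  proof (intro expectation_cong)
    fix vs assume "vs \<in> set_pmf p"
    note vs = le[OF this]
    have "(\<Sum>j\<le>m. \<Sum>i\<le>m. of_bool (d + i = x \<and> e + j = y) * of_bool (f vs = i \<and> g vs = j)) =
        (\<Sum>j\<le>m. if g vs = j then (\<Sum>i\<le>m. if f vs = i then of_bool (d + i = x \<and> e + j = y) else 0)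
          else (0::real))"
      by (intro sum.cong refl) (auto intro!: sum.neutral sum.cong)
    also have "\<dots> = of_bool (d + f vs = x \<and> e + g vs = y)"
      using vs by (simp add: sum.delta')
    finally show "of_bool (d + f vs = x \<and> e + g vs = y) =
      (\<Sum>j\<le>m. \<Sum>i\<le>m. of_bool (d + i = x \<and> e + j = y) * of_bool (f vs = i \<and> g vs = j) :: real)" ..
  qed
  also have "\<dots> = (\<Sum>j\<le>m. \<Sum>i\<le>m. of_bool (d + i = x \<and> e + j = y) *
      measure_pmf.expectation p (\<lambda>vs. of_bool (f vs = i \<and> g vs = j)))"
    by (simp only: expectation_sum[OF fin] integral_mult_right_zero)
  finally show ?thesis by (simp only: prob_expectation)
qed

text \<open>
  The other \<open>n - 2\<close> vertices use up at least \<open>m * (n - 2)\<close> of the total degree.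
\<close>

lemma two_degrees_le:
  assumes G: "pa_graph m n G" and v: "v \<in> {1..n}" and w: "w \<in> {1..n}" and vw: "v \<noteq> w"
  shows "deg G v + deg G w + m * (n - 2) \<le> 2 * m * n - m"
proof -
  have "2 * m * n - m = (\<Sum>u\<in>{1..n}. deg G u)"
    using G by (simp add: pa_graph_def)
  also have "\<dots> = deg G v + (deg G w + (\<Sum>u\<in>{1..n} - {v} - {w}. deg G u))"
    using v w vw by (subst sum.remove[of _ v], simp, simp, subst sum.remove[of _ w]) auto
  also have "(\<Sum>u\<in>{1..n} - {v} - {w}. deg G u) \<ge> (\<Sum>u\<in>{1..n} - {v} - {w}. m)"
    using G by (intro sum_mono) (simp add: pa_graph_def)
  moreover have "(\<Sum>u\<in>{1..n} - {v} - {w}. m) = m * (n - 2)"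
    using v w vw by (simp add: numeral_2_eq_2)
  ultimately show ?thesis by linarith
qed

text \<open>
  The probability of a state is a combination of the probabilities of its possible predecessors,
  all of them at most \<open>B\<close>, with weights of total \<open>1 - 2 * m / T + O(1 / T ^ 2)\<close> by
  \<open>abel_double_sum_le\<close>, where \<open>T\<close> is the total degree.
\<close>

lemma degree_pair_atom_step:
  assumes m: "m \<ge> 2" and n: "n \<ge> 4" and v: "v \<in> {1..n}" and w: "w \<in> {1..n}" and vw: "v \<noteq> w"
    and B: "\<And>x y. measure_pmf.prob (PA m n) {G. deg G v = x \<and> deg G w = y} \<le> B"
  shows "measure_pmf.prob (PA m (Suc n)) {G. deg G v = x \<and> deg G w = y} \<le>
    B * ((2 * real n - 1) / (2 * real n + 1))"
proof -
  have m1: "m \<ge> 1" and n1: "n \<ge> 1" using m n by auto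
  have B0: "0 \<le> B" using B[of 0 0] measure_nonneg order_trans by blast
  define T where "T = real m * (2 * real n - 1)"
  have T: "T > 0" using m n by (simp add: T_def)
  show ?thesis
  \<comment> \<open>Outside this range the state is impossible; inside it all weights in the sums are nonnegative.\<close>
  proof (cases "m \<le> x \<and> m \<le> y \<and> real x + real y \<le> T")
    case False
    have "\<not> (deg G v = x \<and> deg G w = y)" if "G \<in> set_pmf (PA m (Suc n))" for G
    proof
      assume xy: "deg G v = x \<and> deg G w = y"
      have G: "pa_graph m (Suc n) G" using pa_graph_PA[OF m1 _ that] by simp
      then have "m \<le> x" "m \<le> y" using xy v w by (auto simp: pa_graph_def)
      moreover have "real x + real y \<le> T"
      proof -
        have "x + y + m * (Suc n - 2) \<le> 2 * m * Suc n - m"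
          using two_degrees_le[OF G, of v w] v w vw xy by auto
        then have "real (x + y + m * (Suc n - 2)) \<le> real (2 * m * Suc n - m)"
          by (simp only: of_nat_le_iff)
        also have "real (2 * m * Suc n - m) = real m * (2 * real n + 1)"
          by (subst total_degree_real) (simp_all add: algebra_simps)
        also have "real (x + y + m * (Suc n - 2)) = real x + real y + real m * (real n - 1)"
          using n by (simp add: of_nat_diff numeral_2_eq_2)
        finally have "real x + real y \<le> real m * (2 * real n + 1) - real m * (real n - 1)"
          by simp
        also have "\<dots> \<le> T"
        proof -
          have "real m * 3 \<le> real m * real n" using n by (intro mult_left_mono) auto
          then show ?thesis by (simp add: T_def algebra_simps)
        qed
        finally show ?thesis .
      qed
      ultimately show False using False by simp
    qed
    then have "measure_pmf.prob (PA m (Suc n)) {G. deg G v = x \<and> deg G w = y} =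
        measure_pmf.prob (PA m (Suc n)) {G. False}"
      by (intro prob_cong_support) auto
    then show ?thesis using B0 n by simp
  next
    case True
    then have x: "m \<le> x" and y: "m \<le> y" and xy: "real x + real y \<le> T" by auto
    \<comment> \<open>The probability of reaching \<open>(x, y)\<close> from \<open>(x - i, y - j)\<close>.\<close>
    define K where "K = (\<lambda>i j. real ((m choose j) * (m - j choose i)) *
      (((real x - real i) / T) ^ i * ((real y - real j) / T) ^ j *
        (1 - (real x - real i) / T - (real y - real j) / T) ^ (m - j - i)))"
    have q: "pmf (choice_pmf n G) u = (if u \<in> {1..n} then real (deg G u) / T else 0)"
      if "pa_graph m n G" for G u
      unfolding pmf_choice_pmf_graph[OF that m1 n1] total_degree_real[OF n1] T_def by simp
    have K0: "K i j \<ge> 0" if "i \<le> m" "j \<le> m" for i j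
    proof -
      have "(real x - real i) / T + (real y - real j) / T \<le> 1"
        using xy T by (simp add: add_divide_distrib[symmetric])
      then show ?thesis
        unfolding K_def using that x y T
        by (intro mult_nonneg_nonneg zero_le_power divide_nonneg_nonneg) auto
    qed
    have "(\<Sum>j\<le>m. \<Sum>i\<le>m. K i j) = (\<Sum>j\<le>m. real (m choose j) * (real y - real j) ^ j *
        abel_poly (m - j) (T - real y + real j)) / T ^ m"
      unfolding sum_divide_distrib
    proof (intro sum.cong refl)
      fix j assume j: "j \<in> {..m}"
      have "(\<Sum>i\<le>m. K i j) = (\<Sum>i\<le>m - j. K i j)"
        by (intro sum.mono_neutral_right) (auto simp: K_def binomial_eq_0)
      also have "\<dots> = (\<Sum>i\<le>m - j. real (m choose j) * (real y - real j) ^ j / T ^ m *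
          (real (m - j choose i) * ((real x - real i) ^ i *
            ((T - real y + real j) - real x + real i) ^ (m - j - i))))"
      proof (intro sum.cong refl)
        fix i assume i: "i \<in> {..m - j}"
        have "1 - (real x - real i) / T - (real y - real j) / T =
            ((T - real y + real j) - real x + real i) / T"
          using T by (simp add: field_simps)
        moreover have "T ^ m = T ^ i * T ^ j * T ^ (m - j - i)"
          using i j by (simp add: power_add[symmetric])
        ultimately show "K i j = real (m choose j) * (real y - real j) ^ j / T ^ m *
          (real (m - j choose i) * ((real x - real i) ^ i *
            ((T - real y + real j) - real x + real i) ^ (m - j - i)))"
          by (simp add: K_def power_divide mult_ac)
      qed
      also have "\<dots> = real (m choose j) * (real y - real j) ^ j / T ^ m *
          abel_sum (m - j) (real x) (T - real y + real j)"
        by (simp only: sum_distrib_left abel_sum_def)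
      finally show "(\<Sum>i\<le>m. K i j) = real (m choose j) * (real y - real j) ^ j *
          abel_poly (m - j) (T - real y + real j) / T ^ m"
        by (simp add: abel_sum_eq)
    qed
    also have "\<dots> \<le> (T ^ m - 2 * real m * T ^ (m - 1) + 3 * real (m * (m - 1)) * T ^ (m - 2)) / T ^ m"
      using x y xy m T by (intro divide_right_mono abel_double_sum_le) auto
    also have "\<dots> = 1 - 2 * real m / T + 3 * real (m * (m - 1)) / T\<^sup>2"
    proof -
      obtain k where "m = Suc (Suc k)" using m by (metis Suc_le_D numeral_2_eq_2 Suc_le_mono)
      then have e: "T ^ (m - 1) / T ^ m = 1 / T" "T ^ (m - 2) / T ^ m = 1 / T\<^sup>2" "T ^ m / T ^ m = 1"
        using T by (simp_all add: power2_eq_square)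
      show ?thesis
        unfolding add_divide_distrib diff_divide_distrib times_divide_eq_right[symmetric] e by simp
    qed
    also have "\<dots> \<le> (2 * real n - 1) / (2 * real n + 1)"
    proof -
      define u where "u = 2 * real n - 1"
      have u: "u \<ge> 7" using n by (simp add: u_def)
      have "2 * real m / T = 2 / u" using m by (simp add: T_def u_def)
      moreover have "3 * real (m * (m - 1)) / T\<^sup>2 \<le> 3 * (real m)\<^sup>2 / T\<^sup>2"
        by (intro divide_right_mono) (auto simp: power2_eq_square algebra_simps of_nat_diff)
      moreover have "3 * (real m)\<^sup>2 / T\<^sup>2 = 3 / u\<^sup>2"
        using m by (simp add: T_def u_def power_mult_distrib)
      moreover have "(2 * real n - 1) / (2 * real n + 1) = u / (u + 2)" by (simp add: u_def)
      moreover have "1 - 2 / u + 3 / u\<^sup>2 \<le> u / (u + 2)"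
      proof -
        have "0 \<le> u * (u - 6)" using u by (intro mult_nonneg_nonneg) auto
        then show ?thesis using u by (simp add: field_simps power2_eq_square power3_eq_cube)
      qed
      ultimately show ?thesis by linarith
    qed
    finally have "(\<Sum>j\<le>m. \<Sum>i\<le>m. K i j) \<le> (2 * real n - 1) / (2 * real n + 1)" .
    then have "B * (\<Sum>j\<le>m. \<Sum>i\<le>m. K i j) \<le> B * ((2 * real n - 1) / (2 * real n + 1))"
      using B0 by (rule mult_left_mono)
    have "measure_pmf.prob (PA m (Suc n)) {G. deg G v = x \<and> deg G w = y} =
        measure_pmf.expectation (PA m n) (\<lambda>G. measure_pmf.prob (choices m n G)
          {vs. deg (attach n G vs) v = x \<and> deg (attach n G vs) w = y})"
      unfolding prob_expectation by (rule expectation_PA_Suc[OF m1 n1])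
    also have "\<dots> = measure_pmf.expectation (PA m n)
        (\<lambda>G. \<Sum>j\<le>m. \<Sum>i\<le>m. K i j * of_bool (deg G v = x - i \<and> deg G w = y - j))"
    proof (intro expectation_cong)
      fix G assume "G \<in> set_pmf (PA m n)"
      then have G: "pa_graph m n G" by (rule pa_graph_PA[OF m1 n1])
      have "measure_pmf.prob (choices m n G)
          {vs. deg (attach n G vs) v = x \<and> deg (attach n G vs) w = y} =
        measure_pmf.prob (choices m n G)
          {vs. deg G v + count (mset vs) v = x \<and> deg G w + count (mset vs) w = y}"
        using set_choices(1)[OF G m1 n1] v w by (intro prob_cong_support) (simp add: deg_attach)
      also have "\<dots> = (\<Sum>j\<le>m. \<Sum>i\<le>m. of_bool (deg G v + i = x \<and> deg G w + j = y) *
          measure_pmf.prob (choices m n G) {vs. count (mset vs) v = i \<and> count (mset vs) w = j})"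
      proof (intro prob_shifted_counts finite_choices[OF G m1 n1])
        fix vs assume "vs \<in> set_pmf (choices m n G)"
        then have "length vs = m" by (rule set_choices[OF G m1 n1])
        then show "count (mset vs) v \<le> m \<and> count (mset vs) w \<le> m"
          using count_le_size[of "mset vs"] by auto
      qed
      also have "\<dots> = (\<Sum>j\<le>m. \<Sum>i\<le>m. K i j * of_bool (deg G v = x - i \<and> deg G w = y - j))"
      proof (intro sum.cong refl)
        fix i j assume "j \<in> {..m}" "i \<in> {..m}"
        then have ij: "i \<le> x" "j \<le> y" using x y by auto
        show "of_bool (deg G v + i = x \<and> deg G w + j = y) *
            measure_pmf.prob (choices m n G) {vs. count (mset vs) v = i \<and> count (mset vs) w = j} =
          K i j * of_bool (deg G v = x - i \<and> deg G w = y - j)"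
        proof (cases "deg G v = x - i \<and> deg G w = y - j")
          case True
          then show ?thesis
            using ij v w unfolding choices_def prob_counts_replicate[OF finite_choice_pmf[OF G m1 n1] vw]
            by (simp add: q[OF G] K_def of_nat_diff)
        next
          case False
          then show ?thesis using ij by auto
        qed
      qed
      finally show "measure_pmf.prob (choices m n G)
          {vs. deg (attach n G vs) v = x \<and> deg (attach n G vs) w = y} =
        (\<Sum>j\<le>m. \<Sum>i\<le>m. K i j * of_bool (deg G v = x - i \<and> deg G w = y - j))" .
    qed
    also have "\<dots> = (\<Sum>j\<le>m. \<Sum>i\<le>m. K i j *
        measure_pmf.prob (PA m n) {G. deg G v = x - i \<and> deg G w = y - j})"
      by (simp only: expectation_sum[OF finite_PA[OF m1 n1]] integral_mult_right_zero prob_expectation)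
    also have "\<dots> \<le> (\<Sum>j\<le>m. \<Sum>i\<le>m. K i j * B)"
      by (intro sum_mono mult_left_mono B K0) auto
    also have "\<dots> = B * (\<Sum>j\<le>m. \<Sum>i\<le>m. K i j)"
      by (simp add: sum_distrib_left mult.commute)
    also note \<open>B * (\<Sum>j\<le>m. \<Sum>i\<le>m. K i j) \<le> B * ((2 * real n - 1) / (2 * real n + 1))\<close>
    finally show ?thesis .
  qed
qed

lemma degree_pair_atom:
  assumes m: "m \<ge> 2" and s: "s \<ge> 4" and n: "s \<le> n"
    and v: "v \<in> {1..s}" and w: "w \<in> {1..s}" and vw: "v \<noteq> w"
  shows "measure_pmf.prob (PA m n) {G. deg G v = x \<and> deg G w = y} \<le>
    (2 * real s - 1) / (2 * real n - 1)"
  using n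
proof (induction n arbitrary: x y rule: nat_induct_at_least)
  case base
  then show ?case using s by simp
next
  case (Suc n)
  have "measure_pmf.prob (PA m (Suc n)) {G. deg G v = x \<and> deg G w = y} \<le>
      (2 * real s - 1) / (2 * real n - 1) * ((2 * real n - 1) / (2 * real n + 1))"
    using Suc s v w by (intro degree_pair_atom_step m vw Suc.IH) auto
  also have "\<dots> = (2 * real s - 1) / (2 * real (Suc n) - 1)"
    using Suc.hyps s by simp
  finally show ?case .
qed

text \<open>
  Either the common degree exceeds \<open>n\<close> to the power \<open>3 / 4\<close>, which Markov's inequality makes unlikely
  because degrees are of order at most \<open>\<surd>n\<close>, or the pair of degrees is one of the remaining diagonal
  atoms.
\<close>

lemma prob_same_degree:
  assumes m: "m \<ge> 2" and s: "s \<ge> 4" and n: "s \<le> n"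
    and v: "v \<in> {1..s}" and w: "w \<in> {1..s}" and vw: "v \<noteq> w"
  shows "measure_pmf.prob (PA m n) {G. deg G v = deg G w} \<le>
    (3 * real m * exp 2 + 4) * real s * real n powr (- 1 / 4)"
proof -
  have m1: "m \<ge> 1" and n1: "n \<ge> 1" using m s n by auto
  note fin = finite_PA[OF m1 n1]
  define L where "L = real n powr (3 / 4)"
  have L1: "L \<ge> 1" using n1 by (simp add: L_def ge_one_powr_ge_zero)
  define N where "N = nat \<lfloor>L\<rfloor>"
  have N: "real N \<le> L" "L < real N + 1" using L1 by (simp_all add: N_def)
  have "measure_pmf.prob (PA m n) {G. deg G v = deg G w} \<le>
      measure_pmf.expectation (PA m n)
        (\<lambda>G. shifted_deg m G v / L + (\<Sum>x\<le>N. of_bool (deg G v = x \<and> deg G w = x)))"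
    unfolding prob_expectation
  proof (intro expectation_mono fin)
    fix G
    show "of_bool (deg G v = deg G w) \<le>
        shifted_deg m G v / L + (\<Sum>x\<le>N. of_bool (deg G v = x \<and> deg G w = x))"
    proof (cases "deg G v = deg G w \<and> deg G v \<le> N")
      case True
      then have "(\<Sum>x\<le>N. of_bool (deg G v = x \<and> deg G w = x)) = (1::real)"
        by (subst sum.remove[of _ "deg G v"]) auto
      moreover have "0 \<le> shifted_deg m G v / L" using L1 by (simp add: shifted_deg_def)
      ultimately show ?thesis by simp
    next
      case False
      have "1 \<le> shifted_deg m G v / L" if "\<not> deg G v \<le> N"
      proof -
        have "real N + 1 \<le> real (deg G v)" using that by simp
        then show ?thesis using N L1 by (simp add: shifted_deg_def field_simps)
      qed
      moreover have "0 \<le> shifted_deg m G v / L" using L1 by (simp add: shifted_deg_def)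
      moreover have "0 \<le> (\<Sum>x\<le>N. of_bool (deg G v = x \<and> deg G w = x) :: real)"
        by (intro sum_nonneg) auto
      ultimately show ?thesis using False by auto
    qed
  qed
  also have "\<dots> = measure_pmf.expectation (PA m n) (\<lambda>G. shifted_deg m G v) / L +
      (\<Sum>x\<le>N. measure_pmf.prob (PA m n) {G. deg G v = x \<and> deg G w = x})"
    by (subst Bochner_Integration.integral_add)
      (simp_all only: integrable_measure_pmf_finite[OF fin] expectation_sum[OF fin] prob_expectation
        integral_divide_zero)
  also have "\<dots> \<le> 3 * real m * (exp 2 * sqrt (real n)) / L +
      (\<Sum>x\<le>N. (2 * real s - 1) / (2 * real n - 1))"
  proof (intro add_mono divide_right_mono sum_mono degree_pair_atom m s n v w vw)
    have "measure_pmf.expectation (PA m n) (\<lambda>G. shifted_deg m G v) \<le> 3 * real m * (growth n / growth v)"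
      using expectation_degree_product[OF m1 n1, of "{#v#}"] v n m1 by simp
    also have "\<dots> \<le> 3 * real m * (exp 2 * sqrt (real n))"
    proof (intro mult_left_mono)
      have "(growth n / growth v)\<^sup>2 \<le> 2 * exp 2 * (real n / real v)"
        using v n1 by (intro growth_quotient_sq) auto
      also have "\<dots> \<le> exp 2 * exp 2 * real n"
      proof (intro mult_mono)
        show "(2::real) \<le> exp 2" using exp_ge_add_one_self[of "2::real"] by simp
        show "real n / real v \<le> real n" using v by (simp add: field_simps mult_le_cancel_left1)
      qed auto
      also have "\<dots> = (exp 2 * sqrt (real n))\<^sup>2"
        by (simp add: power_mult_distrib power2_eq_square[of "exp 2"])
      finally show "growth n / growth v \<le> exp 2 * sqrt (real n)"
        by (rule power2_le_imp_le) simp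
    qed simp
    finally show "measure_pmf.expectation (PA m n) (\<lambda>G. shifted_deg m G v) \<le>
        3 * real m * (exp 2 * sqrt (real n))" .
  qed (use L1 in auto)
  also have "\<dots> \<le> (3 * real m * exp 2) * real s * real n powr (- 1 / 4) + 4 * real s * real n powr (- 1 / 4)"
  proof (rule add_mono)
    have "sqrt (real n) / L = real n powr (- 1 / 4)"
      using n1 by (simp add: L_def powr_half_sqrt[symmetric] powr_diff[symmetric])
    then have "3 * real m * (exp 2 * sqrt (real n)) / L = (3 * real m * exp 2) * 1 * real n powr (- 1 / 4)"
      by (metis (no_types, lifting) mult.assoc mult.right_neutral times_divide_eq_right)
    also have "\<dots> \<le> (3 * real m * exp 2) * real s * real n powr (- 1 / 4)"
      using s by (intro mult_right_mono mult_left_mono) auto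
    finally show "3 * real m * (exp 2 * sqrt (real n)) / L \<le>
        (3 * real m * exp 2) * real s * real n powr (- 1 / 4)" .
    have "(\<Sum>x\<le>N. (2 * real s - 1) / (2 * real n - 1)) = (real N + 1) * ((2 * real s - 1) / (2 * real n - 1))"
      by simp
    also have "\<dots> \<le> (2 * L) * (2 * real s / real n)"
      using N L1 s n by (intro mult_mono frac_le) auto
    also have "\<dots> = 4 * real s * (L / real n)" by simp
    also have "L / real n = real n powr (3 / 4 - 1)"
      unfolding L_def powr_diff using n1 by simp
    finally show "(\<Sum>x\<le>N. (2 * real s - 1) / (2 * real n - 1)) \<le> 4 * real s * real n powr (- 1 / 4)"
      by simp
  qed
  finally show ?thesis by (simp add: algebra_simps)
qed

section \<open>From automorphisms to symmetric pairs\<close>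

lemma deg_eq_sum_num_edges:
  assumes "\<forall>e\<in>#G. set_uprod e \<subseteq> {1..n}" "v \<in> {1..n}"
  shows "deg G v = (\<Sum>u\<in>{1..n}. num_edges G u v)"
  using assms(1)
proof (induction G)
  case empty
  then show ?case by (simp add: deg_def num_edges_def)
next
  case (add e G)
  obtain a b where e: "e = Upair a b" by (cases e)
  have ab: "a \<in> {1..n}" "b \<in> {1..n}" using add.prems e by auto
  have "(\<Sum>u\<in>{1..n}. if e = Upair u v then 1 else 0) = (if v \<in> set_uprod e then 1 else (0::nat))"
  proof (cases "v \<in> set_uprod e")
    case True
    then obtain c where c: "e = Upair c v" "c \<in> {1..n}" using e ab by auto
    then have "(\<Sum>u\<in>{1..n}. if e = Upair u v then 1 else 0) = (\<Sum>u\<in>{1..n}. if u = c then 1 else (0::nat))"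
      by (intro sum.cong) auto
    then show ?thesis using True c by simp
  qed (auto intro!: sum.neutral)
  moreover have "deg (add_mset e G) v = (if v \<in> set_uprod e then 1 else 0) + deg G v"
    by (simp add: deg_def)
  moreover have "num_edges (add_mset e G) u v = (if e = Upair u v then 1 else 0) + num_edges G u v" for u
    by (simp add: num_edges_def)
  ultimately show ?case using add by (simp add: sum.distrib)
qed

text \<open>
  The oldest vertex moved by the automorphism and its image have the same parents: those of the
  former are fixed, so they are parents of the latter as well, and both have \<open>m\<close> of them.
\<close>

lemma automorphism_symmetric_pair:
  assumes G: "pa_graph m n G" and m: "m \<ge> 1" and \<pi>: "\<pi> \<in> automorphisms n G" "\<pi> \<noteq> id"
  obtains v w where "2 \<le> v" "v < w" "w \<le> n" "parents G v = parents G w" "deg G v = deg G w"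
proof -
  have perm: "\<pi> permutes {1..n}"
    and edges: "\<And>x y. x \<in> {1..n} \<Longrightarrow> y \<in> {1..n} \<Longrightarrow> num_edges G (\<pi> x) (\<pi> y) = num_edges G x y"
    using \<pi>(1) by (auto simp: automorphisms_def)
  have inj: "inj \<pi>" using perm by (rule permutes_inj)
  define v where "v = (LEAST v. \<pi> v \<noteq> v)"
  have "\<exists>v. \<pi> v \<noteq> v" using \<pi>(2) by auto
  then have v: "\<pi> v \<noteq> v" unfolding v_def by (rule LeastI_ex)
  have fixed: "\<pi> u = u" if "u < v" for u
    using not_less_Least that unfolding v_def by blast
  have v_in: "v \<in> {1..n}" using v perm by (metis permutes_not_in)
  then have w_in: "\<pi> v \<in> {1..n}" using perm by (simp add: permutes_in_image del: atLeastAtMost_iff)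
  have less: "v < \<pi> v"
    using fixed[of "\<pi> v"] v inj by (metis injD linorder_neqE_nat)
  have "v \<noteq> 1"
  proof
    assume "v = 1"
    then have "num_edges G (\<pi> v) (\<pi> v) = m" using edges[OF v_in v_in] G by (simp add: pa_graph_def)
    moreover have "num_edges G (\<pi> v) (\<pi> v) = 0"
      using G w_in less \<open>v = 1\<close> by (simp add: pa_graph_def)
    ultimately show False using m by simp
  qed
  then have v2: "2 \<le> v" using v_in by auto
  have sub: "parents G v \<subseteq># parents G (\<pi> v)"
  proof (rule mset_subset_eqI)
    fix u
    show "count (parents G v) u \<le> count (parents G (\<pi> v)) u"
    proof (cases "u \<in> {1..<v}")
      case True
      then have "num_edges G u (\<pi> v) = num_edges G u v"
        using edges[of u v] fixed[of u] v_in by simp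
      then show ?thesis using True less by (simp add: count_parents)
    next
      case False
      then show ?thesis by (simp only: count_parents if_False)
    qed
  qed
  have "size (parents G v) = m" "size (parents G (\<pi> v)) = m"
    using G v2 v_in w_in less by (auto simp: pa_graph_def)
  then have parents: "parents G v = parents G (\<pi> v)"
    using sub by (metis mset_subset_size subset_mset.le_imp_less_or_eq less_irrefl)
  have loops: "\<forall>e\<in>#G. set_uprod e \<subseteq> {1..n}" using G by (simp add: pa_graph_def)
  have "deg G (\<pi> v) = (\<Sum>u\<in>{1..n}. num_edges G u (\<pi> v))"
    by (rule deg_eq_sum_num_edges[OF loops w_in])
  also have "\<dots> = (\<Sum>u\<in>{1..n}. num_edges G (\<pi> u) (\<pi> v))"
    using sum.permute[OF perm, of "\<lambda>u. num_edges G u (\<pi> v)"] by (simp add: comp_def)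
  also have "\<dots> = (\<Sum>u\<in>{1..n}. num_edges G u v)"
    using v_in by (intro sum.cong refl edges)
  also have "\<dots> = deg G v"
    by (rule deg_eq_sum_num_edges[OF loops v_in, symmetric])
  finally show ?thesis
    using that[OF v2 less _ parents] w_in by simp
qed

lemma id_in_automorphisms: "id \<in> automorphisms n G"
  by (simp add: automorphisms_def permutes_id)

lemma finite_automorphisms: "finite (automorphisms n G)"
proof (rule finite_subset)
  show "automorphisms n G \<subseteq> {\<pi>. \<pi> permutes {1..n}}" by (auto simp: automorphisms_def)
qed (simp add: finite_permutations)

lemma card_automorphisms_pos: "card (automorphisms n G) > 0"
  using id_in_automorphisms finite_automorphisms by (metis card_gt_0_iff empty_iff)

section \<open>Probability of a nontrivial automorphism\<close>

lemma prob_nontrivial_automorphism: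
  assumes m: "m \<ge> 1" and n: "n \<ge> 1"
  shows "measure_pmf.prob (PA m n) {G. card (automorphisms n G) > 1} \<le>
    (\<Sum>(v, w)\<in>{(v, w). 1 \<le> v \<and> v < w \<and> w \<le> s}. measure_pmf.prob (PA m n) {G. deg G v = deg G w}) +
    (\<Sum>(v, w)\<in>{(v, w). 2 \<le> v \<and> v < w \<and> s < w \<and> w \<le> n}. measure_pmf.prob (PA m n) {G. parents G v = parents G w})"
proof -
  define I where "I = {(v, w). 1 \<le> v \<and> v < w \<and> w \<le> s}"
  define J where "J = {(v, w). 2 \<le> v \<and> v < w \<and> s < w \<and> w \<le> n}"
  note fin = finite_PA[OF m n]
  have "finite I" by (rule finite_subset[of _ "{..s} \<times> {..s}"]) (auto simp: I_def)
  have "finite J" by (rule finite_subset[of _ "{..n} \<times> {..n}"]) (auto simp: J_def)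
  have "measure_pmf.prob (PA m n) {G. card (automorphisms n G) > 1} \<le>
      measure_pmf.prob (PA m n) ({G. \<exists>p\<in>I. deg G (fst p) = deg G (snd p)} \<union>
        {G. \<exists>p\<in>J. parents G (fst p) = parents G (snd p)})"
    unfolding Un_def mem_Collect_eq
  proof (rule prob_mono_support[OF fin])
    fix G assume "G \<in> set_pmf (PA m n)" and card: "card (automorphisms n G) > 1"
    then have G: "pa_graph m n G" by (intro pa_graph_PA[OF m n])
    have "automorphisms n G \<noteq> {id}" using card by auto
    then obtain \<pi> where "\<pi> \<in> automorphisms n G" "\<pi> \<noteq> id"
      using id_in_automorphisms[of n G] by blast
    then obtain v w where "2 \<le> v" "v < w" "w \<le> n" "parents G v = parents G w" "deg G v = deg G w"
      by (rule automorphism_symmetric_pair[OF G m])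
    then show "(\<exists>p\<in>I. deg G (fst p) = deg G (snd p)) \<or> (\<exists>p\<in>J. parents G (fst p) = parents G (snd p))"
      by (cases "w \<le> s") (auto simp: I_def J_def)
  qed
  also have "\<dots> \<le> measure_pmf.prob (PA m n) {G. \<exists>p\<in>I. deg G (fst p) = deg G (snd p)} +
      measure_pmf.prob (PA m n) {G. \<exists>p\<in>J. parents G (fst p) = parents G (snd p)}"
    by (rule measure_Un_le) auto
  also have "\<dots> \<le> (\<Sum>p\<in>I. measure_pmf.prob (PA m n) {G. deg G (fst p) = deg G (snd p)}) +
      (\<Sum>p\<in>J. measure_pmf.prob (PA m n) {G. parents G (fst p) = parents G (snd p)})"
    by (intro add_mono prob_Ex_le fin \<open>finite I\<close> \<open>finite J\<close>)
  finally show ?thesis by (simp add: I_def J_def case_prod_beta)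
qed

text \<open>
  The \<open>s ^ 2\<close> old pairs contribute through their degrees.  For the other pairs \<open>w > s\<close>, so a factor
  \<open>s\<close> to the power \<open>- 1 / 4\<close> can be taken out of the summable bound for equal parents.
\<close>

lemma prob_nontrivial_automorphism_bound:
  assumes m: "m \<ge> 3"
  obtains K where "\<And>s n. 4 \<le> s \<Longrightarrow> s \<le> n \<Longrightarrow>
    measure_pmf.prob (PA m n) {G. card (automorphisms n G) > 1} \<le>
      K * (real s ^ 3 * real n powr (- 1 / 4) + real s powr (- 1 / 4))"
proof -
  obtain C where C: "C > 0" "\<And>v w n. 2 \<le> v \<Longrightarrow> v < w \<Longrightarrow> w \<le> n \<Longrightarrow>
    measure_pmf.prob (PA m n) {G. parents G v = parents G w} \<le>
      C * (real v powr (- 5 / 4) * real w powr (- 3 / 2))"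
    using prob_same_parents[OF m] by blast
  define Z where "Z = (\<Sum>u. real u powr (- 5 / 4))"
  have summable: "summable (\<lambda>u. real u powr (- 5 / 4))"
    by (simp add: summable_real_powr_iff)
  define D where "D = 3 * real m * exp 2 + 4"
  define K where "K = max D (C * Z\<^sup>2)"
  have "measure_pmf.prob (PA m n) {G. card (automorphisms n G) > 1} \<le>
      K * (real s ^ 3 * real n powr (- 1 / 4) + real s powr (- 1 / 4))"
    if s: "4 \<le> s" and n: "s \<le> n" for s n
  proof -
    define I where "I = {(v, w). 1 \<le> v \<and> v < w \<and> w \<le> s}"
    define J where "J = {(v, w). 2 \<le> v \<and> v < w \<and> s < w \<and> w \<le> n}"
    have I: "I \<subseteq> {1..s} \<times> {1..s}" and J: "J \<subseteq> {..<Suc n} \<times> {..<Suc n}"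
      by (auto simp: I_def J_def)
    have "(\<Sum>(v, w)\<in>I. measure_pmf.prob (PA m n) {G. deg G v = deg G w}) \<le>
        (\<Sum>(v, w)\<in>I. D * real s * real n powr (- 1 / 4))"
    proof (intro sum_mono, clarify)
      fix v w assume "(v, w) \<in> I"
      then show "measure_pmf.prob (PA m n) {G. deg G v = deg G w} \<le> D * real s * real n powr (- 1 / 4)"
        unfolding D_def using m s n by (intro prob_same_degree) (auto simp: I_def)
    qed
    also have "\<dots> = real (card I) * (D * real s * real n powr (- 1 / 4))"
      by (simp add: case_prod_beta)
    also have "\<dots> \<le> (real s * real s) * (D * real s * real n powr (- 1 / 4))"
    proof (intro mult_right_mono)
      have "card I \<le> s * s" using card_mono[OF _ I] by simp
      then show "real (card I) \<le> real s * real s" by (metis of_nat_le_iff of_nat_mult)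
    qed (simp add: D_def)
    also have "\<dots> = D * (real s ^ 3 * real n powr (- 1 / 4))"
      by (simp add: power3_eq_cube)
    finally have 1: "(\<Sum>(v, w)\<in>I. measure_pmf.prob (PA m n) {G. deg G v = deg G w}) \<le>
        D * (real s ^ 3 * real n powr (- 1 / 4))" .
    have "(\<Sum>(v, w)\<in>J. measure_pmf.prob (PA m n) {G. parents G v = parents G w}) \<le>
        (\<Sum>(v, w)\<in>J. (C * real s powr (- 1 / 4)) * (real v powr (- 5 / 4) * real w powr (- 5 / 4)))"
    proof (intro sum_mono, clarify)
      fix v w assume "(v, w) \<in> J"
      then have vw: "2 \<le> v" "v < w" "s < w" "w \<le> n" by (auto simp: J_def)
      have "real w powr (- 3 / 2) = real w powr (- 1 / 4) * real w powr (- 5 / 4)"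
        by (simp add: powr_add[symmetric])
      also have "\<dots> \<le> real s powr (- 1 / 4) * real w powr (- 5 / 4)"
        using vw s by (intro mult_right_mono powr_mono2') auto
      finally have "C * (real v powr (- 5 / 4) * real w powr (- 3 / 2)) \<le>
          C * (real v powr (- 5 / 4) * (real s powr (- 1 / 4) * real w powr (- 5 / 4)))"
        using C(1) by (intro mult_left_mono) auto
      with C(2)[OF vw(1,2,4)]
      show "measure_pmf.prob (PA m n) {G. parents G v = parents G w} \<le>
          (C * real s powr (- 1 / 4)) * (real v powr (- 5 / 4) * real w powr (- 5 / 4))"
        by (simp add: mult_ac)
    qed
    also have "\<dots> \<le> (\<Sum>(v, w)\<in>{..<Suc n} \<times> {..<Suc n}.
        (C * real s powr (- 1 / 4)) * (real v powr (- 5 / 4) * real w powr (- 5 / 4)))"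
      using C(1) J by (intro sum_mono2) (auto simp: case_prod_beta)
    also have "\<dots> = C * real s powr (- 1 / 4) *
        ((\<Sum>v<Suc n. real v powr (- 5 / 4)) * (\<Sum>w<Suc n. real w powr (- 5 / 4)))"
      unfolding sum_product sum.cartesian_product by (simp add: sum_distrib_left case_prod_beta)
    also have "\<dots> \<le> C * real s powr (- 1 / 4) * (Z * Z)"
    proof -
      have "(\<Sum>v<Suc n. real v powr (- 5 / 4)) \<le> Z"
        unfolding Z_def by (intro sum_le_suminf summable) auto
      moreover have "0 \<le> (\<Sum>v<Suc n. real v powr (- 5 / 4))" by (intro sum_nonneg) simp
      ultimately show ?thesis
        using C(1) by (intro mult_left_mono mult_mono) auto
    qed
    finally have 2: "(\<Sum>(v, w)\<in>J. measure_pmf.prob (PA m n) {G. parents G v = parents G w}) \<le>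
        (C * Z\<^sup>2) * real s powr (- 1 / 4)"
      by (simp add: power2_eq_square mult_ac)
    have "measure_pmf.prob (PA m n) {G. card (automorphisms n G) > 1} \<le>
        D * (real s ^ 3 * real n powr (- 1 / 4)) + (C * Z\<^sup>2) * real s powr (- 1 / 4)"
      using prob_nontrivial_automorphism[of m n s] 1 2 m s n unfolding I_def J_def by simp
    also have "\<dots> \<le> K * (real s ^ 3 * real n powr (- 1 / 4)) + K * real s powr (- 1 / 4)"
      by (intro add_mono mult_right_mono) (auto simp: K_def)
    finally show ?thesis by (simp add: algebra_simps)
  qed
  then show ?thesis by (rule that)
qed

theorem theorem1:
  fixes m :: nat
  assumes "m \<ge> 3"
  shows "(\<lambda>n. measure_pmf.prob (PA m n) {G. card (automorphisms n G) = 1})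
           \<longlonglongrightarrow> 1 \<and>
         (\<exists>\<delta>>0. (\<lambda>n. measure_pmf.prob (PA m n) {G. card (automorphisms n G) > 1})
                  \<in> O(\<lambda>n. real n powr (- \<delta>)))"
proof -
  define p where "p = (\<lambda>n. measure_pmf.prob (PA m n) {G. card (automorphisms n G) > 1})"
  obtain K where K: "\<And>s n. 4 \<le> s \<Longrightarrow> s \<le> n \<Longrightarrow>
      p n \<le> K * (real s ^ 3 * real n powr (- 1 / 4) + real s powr (- 1 / 4))"
    using prob_nontrivial_automorphism_bound[OF assms] unfolding p_def by blast
  have K0: "0 \<le> K"
  proof -
    have "0 \<le> p 4" by (simp add: p_def)
    also have "p 4 \<le> K * (real 4 ^ 3 * real 4 powr (- 1 / 4) + real 4 powr (- 1 / 4))"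
      by (rule K) auto
    finally show ?thesis by (simp add: zero_le_mult_iff)
  qed
  have bound: "p n \<le> (126 * K) * real n powr (- 1 / 96)" if n: "n \<ge> 24" for n
  proof -
    \<comment> \<open>With \<open>s\<close> of order \<open>r\<close>, the contributions are of order \<open>n\<close> to the powers \<open>- 1 / 8\<close> and \<open>- 1 / 96\<close>.\<close>
    define r where "r = real n powr (1 / 24)"
    have r1: "r \<ge> 1" using n by (simp add: r_def ge_one_powr_ge_zero)
    have r24: "r ^ 24 = real n" using n by (simp add: r_def powr_power)
    define s where "s = nat \<lfloor>r\<rfloor> + 4"
    have s: "r \<le> real s" "real s \<le> 5 * r" "4 \<le> s" using r1 by (simp_all add: s_def) linarith+
    have "s \<le> n"
    proof (cases "r \<le> 2")
      case True
      then show ?thesis using n unfolding s_def by linarith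
    next
      case False
      have "2 ^ 23 * r \<le> r ^ 23 * r" using False by (intro mult_right_mono power_mono) auto
      also have "\<dots> = real n" using r24 by (simp add: power_Suc2[symmetric])
      finally show ?thesis using s(2) r1 by simp
    qed
    then have "p n \<le> K * (real s ^ 3 * real n powr (- 1 / 4) + real s powr (- 1 / 4))"
      using s(3) by (intro K)
    also have "\<dots> \<le> K * ((5 * r) ^ 3 * real n powr (- 1 / 4) + r powr (- 1 / 4))"
      using s r1 K0 by (intro mult_left_mono add_mono mult_right_mono power_mono powr_mono2') auto
    also have "\<dots> = K * (125 * real n powr (- 1 / 8) + real n powr (- 1 / 96))"
      using n by (simp add: r_def power_mult_distrib powr_power powr_powr powr_add[symmetric])
    also have "\<dots> \<le> K * (125 * real n powr (- 1 / 96) + real n powr (- 1 / 96))"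
      using n K0 by (intro mult_left_mono add_mono powr_mono) auto
    finally show ?thesis by simp
  qed
  have ev: "\<forall>\<^sub>F n in sequentially. norm (p n) \<le> (126 * K) * norm (real n powr (- 1 / 96))"
    using eventually_ge_at_top[of 24] by eventually_elim (use bound in \<open>simp add: p_def\<close>)
  then have bigo: "p \<in> O(\<lambda>n. real n powr (- (1 / 96)))"
    by (intro bigoI[of _ "126 * K"]) simp
  have "(\<lambda>n. real n powr (- (1 / 96))) \<longlonglongrightarrow> 0"
    by (intro tendsto_neg_powr filterlim_real_sequentially) simp
  then have "(\<lambda>n. (126 * K) * norm (real n powr (- 1 / 96))) \<longlonglongrightarrow> 0"
    by (intro tendsto_mult_right_zero) simp
  with ev have "p \<longlonglongrightarrow> 0"
    by (rule Lim_null_comparison)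
  then have "(\<lambda>n. 1 - p n) \<longlonglongrightarrow> 1 - 0" by (intro tendsto_intros)
  moreover have "measure_pmf.prob (PA m n) {G. card (automorphisms n G) = 1} = 1 - p n" for n
  proof -
    have "{G. card (automorphisms n G) = 1} = UNIV - {G. card (automorphisms n G) > 1}"
      using card_automorphisms_pos[of n] by (auto simp: not_less) (metis Suc_leI le_antisym One_nat_def)
    then show ?thesis
      using measure_pmf.prob_compl[of "{G. card (automorphisms n G) > 1}" "PA m n"] by (simp add: p_def)
  qed
  ultimately have "(\<lambda>n. measure_pmf.prob (PA m n) {G. card (automorphisms n G) = 1}) \<longlonglongrightarrow> 1"
    by simp
  then show ?thesis using bigo unfolding p_def by (intro conjI exI[of _ "1 / 96"]) auto
qed

end
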